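(* Let $x\in V$ (i.e. $x\colon[0,+\infty)\to\mathbb{R}$ is càdlàg with locally finite total variation), let $g:\mathbb{R}\to\mathbb{R}$ be Borel-measurable and locally bounded, and define $f:\mathbb{R}\to\mathbb{R}$ by $f(y):=f_0+\int_{[0,y]}g(z)\,dz$ if $y\ge0$ and $f(y):=f_0-\int_{[y,0]}g(z)\,dz$ if $y<0$, with $f_0\in\mathbb{R}$; or, equivalently, let $f:\mathbb{R}\to\mathbb{R}$ be locally Lipschitz with $f(y)=f(0)+\int_{[0,y]}g(z)\,dz=f(0)+\int_{[0,y]}f'(z)\,dz$ if $y\ge0$ and $f(y)=f(0)-\int_{[y,0]}g(z)\,dz=f(0)-\int_{[y,0]}f'(z)\,dz$ if $y<0$, for some Borel-measurable and locally integrable $g:\mathbb{R}\to\mathbb{R}$. Then for every $t>0$ \begin{align*} f(x_t)-f(x_0)&=\int_{\mathbb{R}}\{\mathrm{u}^{z}(x,[0,t])-\mathrm{d}^{z}(x,[0,t])\}\,g(z)\,dz\\ &=\int_{\mathbb{R}}\ell^z(t)\,g(z)\,dz+\sum_{0<s\le t,\ \Delta x_{s}\neq0}\{f(x_{s})-f(x_{s-})\}. \end{align*}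
   Context: **Spaces.** $D$ is the set of càdlàg functions $x\colon[0,+\infty)\to\mathbb{R}$ (right-continuous on $[0,+\infty)$, with left limits $x_{s-}$ at every $s>0$); $x_s=x(s)$. $V\subset D$ is the subset of functions with locally finite total variation (finite total variation on every $[s,t]$, $0\le s<t<\infty$). $\Delta x_s=x_s-x_{s-}$ for $s>0$. **Summation.** For a set $I$ and $b\colon I\to\mathbb{R}$, $\sum_{i\in I}b_i$ is the limit of the net of finite partial sums $\sum_{i\in\Gamma}b_i$, over finite $\Gamma\subseteq I$ directed by inclusion. **Interval crossings.** Let $y\in\mathbb{R}$, $c>0$, $x\in D$ and $0\le s<t$. Put $\sigma_0^c=s$ and, for $n=0,1,2,\dots$, $$\tau_n^c=\inf\{u\in[\sigma_n^c,t]: x(u)\ge y+c/2\},\qquad \sigma_{n+1}^c=\inf\{u\in[\tau_n^c,t]: x(u)<y-c/2\},$$ with the conventions $\inf\emptyset=+\infty$, $[+\infty,t]=\emptyset$. The number of downcrossings of $[y-c/2,y+c/2]$ by $x$ during $[s,t]$ is $\mathrm{d}^{y,c}(x,[s,t]):=\max\{n:\sigma_n^c\le t\}$, and the number of upcrossings is $\mathrm{u}^{y,c}(x,[s,t]):=\mathrm{d}^{-y,c}(-x,[s,t])$. **Level crossings.** For $y\in\mathbb{R}$, with values in $\{0,1,2,\dots\}\cup\{+\infty\}$, $$\mathrm{d}^{y}(x,[s,t])=\lim_{c\to0+}\mathrm{d}^{y,c}(x,[s,t]),\qquad \mathrm{u}^{y}(x,[s,t])=\lim_{c\to0+}\mathrm{u}^{y,c}(x,[s,t]).$$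 **Local time.** For $z\in\mathbb{R}$, $\mathcal{I}(z)$ is the set of $t>0$ such that $x$ is continuous at $t$, $x(t)=z$, and the sign of $x(t)-x(s)$ equals the sign of $t-s$ for all $s$ in some neighborhood of $t$. $\mathcal{D}(z)$ is the set of $t>0$ such that $x$ is continuous at $t$, $x(t)=z$, and the sign of $x(t)-x(s)$ equals the sign of $s-t$ for all $s$ in some neighborhood of $t$. Then $\ell^z(t)=\mathrm{Card}(\mathcal{I}(z)\cap(0,t])-\mathrm{Card}(\mathcal{D}(z)\cap(0,t])$. The differences defining $\ell^z(t)$ and $\mathrm{u}^z-\mathrm{d}^z$ are understood for Lebesgue-almost every $z$, where the terms are finite. *)

theory Defs
  imports "HOL-Analysis.Analysis"
begin

text \<open>
  A function on \<open>[0,\<infinity>)\<close> is represented by a total function \<open>x :: real \<Rightarrow> real\<close>. Nothing below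
  depends on its values at negative arguments as long as the time arguments are nonnegative.
\<close>

definition cadlag :: "(real \<Rightarrow> real) \<Rightarrow> bool" where
  "cadlag x \<longleftrightarrow>
     (\<forall>s\<ge>0. (x \<longlongrightarrow> x s) (at_right s)) \<and> (\<forall>s>0. \<exists>l. (x \<longlongrightarrow> l) (at_left s))"

definition left_lim :: "(real \<Rightarrow> real) \<Rightarrow> real \<Rightarrow> real" where
  "left_lim x s = Lim (at_left s) x"

definition jump :: "(real \<Rightarrow> real) \<Rightarrow> real \<Rightarrow> real" where
  "jump x s = x s - left_lim x s"

definition total_variation :: "(real \<Rightarrow> real) \<Rightarrow> real \<Rightarrow> real \<Rightarrow> ennreal" where
  "total_variation x s t =
     (SUP (n, p) \<in> {(n :: nat, p :: nat \<Rightarrow> real). p 0 = s \<and> p n = t \<and> (\<forall>i<n. p i \<le> p (Suc i))}.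
        ennreal (\<Sum>i<n. \<bar>x (p (Suc i)) - x (p i)\<bar>))"

definition cadlag_fv :: "(real \<Rightarrow> real) \<Rightarrow> bool" where
  "cadlag_fv x \<longleftrightarrow> cadlag x \<and> (\<forall>s t. 0 \<le> s \<longrightarrow> s < t \<longrightarrow> total_variation x s t < \<infinity>)"

text \<open>
  \<open>first_time P a t\<close> is the infimum of \<open>{u \<in> [a,t]. P u}\<close> in the extended reals; the infimum of the
  empty set is \<open>\<infinity>\<close>, and \<open>[\<infinity>,t]\<close> is empty.
\<close>

definition first_time :: "(real \<Rightarrow> bool) \<Rightarrow> ereal \<Rightarrow> real \<Rightarrow> ereal" where
  "first_time P a t = (INF u \<in> {u. a \<le> ereal u \<and> u \<le> t \<and> P u}. ereal u)"

primrec down_time :: "real \<Rightarrow> real \<Rightarrow> (real \<Rightarrow> real) \<Rightarrow> real \<Rightarrow> real \<Rightarrow> nat \<Rightarrow> ereal" where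
  "down_time y c x s t 0 = ereal s"
| "down_time y c x s t (Suc n) =
     (let tau = first_time (\<lambda>u. x u \<ge> y + c / 2) (down_time y c x s t n) t
      in first_time (\<lambda>u. x u < y - c / 2) tau t)"

text \<open>The sets whose maximum is taken are finite for cadlag \<open>x\<close>, \<open>c > 0\<close> and \<open>0 \<le> s < t\<close>.\<close>

definition downcrossings :: "real \<Rightarrow> real \<Rightarrow> (real \<Rightarrow> real) \<Rightarrow> real \<Rightarrow> real \<Rightarrow> nat" where
  "downcrossings y c x s t = Max {n. down_time y c x s t n \<le> ereal t}"

definition upcrossings :: "real \<Rightarrow> real \<Rightarrow> (real \<Rightarrow> real) \<Rightarrow> real \<Rightarrow> real \<Rightarrow> nat" where
  "upcrossings y c x s t = downcrossings (- y) c (\<lambda>u. - x u) s t"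

definition level_down :: "real \<Rightarrow> (real \<Rightarrow> real) \<Rightarrow> real \<Rightarrow> real \<Rightarrow> enat" where
  "level_down y x s t = Lim (at_right 0) (\<lambda>c. enat (downcrossings y c x s t))"

definition level_up :: "real \<Rightarrow> (real \<Rightarrow> real) \<Rightarrow> real \<Rightarrow> real \<Rightarrow> enat" where
  "level_up y x s t = Lim (at_right 0) (\<lambda>c. enat (upcrossings y c x s t))"

text \<open>The difference is meaningful only where both terms are finite.\<close>

definition net_crossings :: "real \<Rightarrow> (real \<Rightarrow> real) \<Rightarrow> real \<Rightarrow> real \<Rightarrow> real" where
  "net_crossings y x s t = real (the_enat (level_up y x s t)) - real (the_enat (level_down y x s t))"

definition incr_times :: "(real \<Rightarrow> real) \<Rightarrow> real \<Rightarrow> real set" where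
  "incr_times x z =
     {t. t > 0 \<and> isCont x t \<and> x t = z \<and> (\<forall>\<^sub>F s in nhds t. sgn (x t - x s) = sgn (t - s))}"

definition decr_times :: "(real \<Rightarrow> real) \<Rightarrow> real \<Rightarrow> real set" where
  "decr_times x z =
     {t. t > 0 \<and> isCont x t \<and> x t = z \<and> (\<forall>\<^sub>F s in nhds t. sgn (x t - x s) = sgn (s - t))}"

text \<open>Meaningful only where both sets are finite.\<close>

definition local_time :: "(real \<Rightarrow> real) \<Rightarrow> real \<Rightarrow> real \<Rightarrow> real" where
  "local_time x z t =
     real (card (incr_times x z \<inter> {0<..t})) - real (card (decr_times x z \<inter> {0<..t}))"

definition locally_bounded :: "(real \<Rightarrow> real) \<Rightarrow> bool" where
  "locally_bounded g \<longleftrightarrow> (\<forall>y. \<exists>e>0. bounded (g ` ball y e))"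

definition locally_lipschitz :: "(real \<Rightarrow> real) \<Rightarrow> bool" where
  "locally_lipschitz f \<longleftrightarrow> (\<forall>y. \<exists>e>0. \<exists>L. L-lipschitz_on (ball y e) f)"

definition locally_integrable :: "(real \<Rightarrow> real) \<Rightarrow> bool" where
  "locally_integrable g \<longleftrightarrow> (\<forall>K. compact K \<longrightarrow> set_integrable lebesgue K g)"

definition primitive :: "real \<Rightarrow> (real \<Rightarrow> real) \<Rightarrow> real \<Rightarrow> real" where
  "primitive f0 g y =
     (if y \<ge> 0 then f0 + (LINT z:{0..y}|lebesgue. g z) else f0 - (LINT z:{y..0}|lebesgue. g z))"

end

theory Submission
  imports Defs
begin

text \<open>
  By Banach's indicatrix argument almost every level \<open>z\<close> is crossed only finitely often on \<open>[0,t]\<close>;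
  outside a further countable set, \<open>z\<close> is not an endpoint value, not a value next to a jump and not a
  local extremum. At such a level up- and downcrossings alternate, so \<open>u - d\<close> is the
  difference of the indicators of \<open>z < x t\<close> and \<open>z < x 0\<close>; integrated against \<open>g\<close> this is \<open>f (x t) - f (x 0)\<close>.
  On the other hand the indicator of \<open>z < x s\<close> changes with \<open>s\<close> only at the finitely many times
  counted by the local time and at the jumps across \<open>z\<close>. Hence \<open>u - d\<close> is the local time plus
  the signed number of jumps across \<open>z\<close>, and Fubini turns the latter into the jump sum, since
  the jumps are summable and \<open>g\<close> is essentially bounded on the range of \<open>x\<close>.
\<close>

subsection \<open>Alternation of a path around a level\<close>

text \<open>The downcrossing times are infima that need not be attained and that move with
  \<open>c\<close>. They are replaced by \<open>alternates P Q s n e\<close>: \<open>n\<close>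
  ordered points of [s, e] that satisfy \<open>P\<close> and \<open>Q\<close> in turn,
  \<open>P\<close> first. Such a chain has finitely many witnesses, so it survives any limit in
  which each single witness survives: \<open>c\<close> to 0 for the level crossings, mesh to 0 for
  the grid sums. Right-continuity turns passage times into chains. A generic level is still attained
  at its continuous crossings, so signs are read off from one-sided neighbourhoods
  (\<open>above_left\<close>, \<open>above\<close>) and not from \<open>x s\<close>. Measurability
  in \<open>z\<close> of the crossing counts and of the local time is never proved directly:
  multiplied by \<open>g\<close>, they agree almost everywhere with integrable functions, and
  Lebesgue measure is complete. Fubini uses an essential bound of \<open>g\<close> on the range of
  \<open>x\<close>, while the Lipschitz alternative only grants local integrability of
  \<open>g\<close>; the bound is recovered from the monotonicity of \<open>L * y + f y\<close> and
  \<open>L * y - f y\<close>.\<close>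

primrec alternates :: "(real \<Rightarrow> bool) \<Rightarrow> (real \<Rightarrow> bool) \<Rightarrow> real \<Rightarrow> nat \<Rightarrow> real \<Rightarrow> bool" where
  "alternates P Q s 0 e \<longleftrightarrow> s \<le> e"
| "alternates P Q s (Suc n) e \<longleftrightarrow>
     (\<exists>a\<le>e. alternates P Q s n a \<and> (if even n then P a else Q a))"

lemma alternates_mono_end: "alternates P Q s n e \<Longrightarrow> e \<le> e' \<Longrightarrow> alternates P Q s n e'"
  by (cases n) (auto intro: order_trans)

lemma alternates_mono_start: "alternates P Q s n e \<Longrightarrow> s' \<le> s \<Longrightarrow> alternates P Q s' n e"
  by (induction n arbitrary: e) auto

lemma alternates_ge: "alternates P Q s n e \<Longrightarrow> s \<le> e"
  by (induction n arbitrary: e) fastforce+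

lemma alternates_antimono:
  assumes "alternates P Q s n e" "m \<le> n"
  shows "alternates P Q s m e"
  using assms(2,1) by (induction rule: inc_induct) (auto intro: alternates_mono_end)

lemma alternates_prepend:
  assumes "P s'" "s \<le> s'" "alternates Q P s' n e"
  shows "alternates P Q s (Suc n) e"
  using assms(3)
proof (induction n arbitrary: e)
  case 0
  then show ?case using assms by auto
next
  case (Suc n)
  then obtain a where a: "a \<le> e" "alternates Q P s' n a" "if even n then Q a else P a"
    by auto
  then have "alternates P Q s (Suc n) a"
    using Suc.IH by blast
  then show ?case
    using a unfolding alternates.simps(2)[of P Q s "Suc n"] by (auto split: if_splits)
qed

lemma alternates_drop:
  "alternates P Q s (Suc n) e \<Longrightarrow> alternates Q P s n e"
proof (induction n arbitrary: e)
  case 0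
  then show ?case by (auto dest: alternates_ge)
next
  case (Suc n)
  then obtain a where a: "a \<le> e" "alternates P Q s (Suc n) a"
    "if even (Suc n) then P a else Q a"
    by (metis alternates.simps(2))
  then show ?case
    using Suc.IH[OF a(2)] by (auto split: if_splits)
qed

lemma alternates_append:
  assumes "alternates P Q s n a" "if even n then P a else Q a" "a \<le> e"
  shows "alternates P Q s (Suc n) e"
  using assms by auto

text \<open>The witnesses of the chain stay fixed; each satisfies the perturbed predicate
  eventually, and finitely many such conditions hold eventually together.\<close>

lemma eventually_alternates:
  assumes "alternates P Q s n e"
    and P: "\<And>a. s \<le> a \<Longrightarrow> P a \<Longrightarrow> \<forall>\<^sub>F c in F. P' c a"
    and Q: "\<And>a. s \<le> a \<Longrightarrow> Q a \<Longrightarrow> \<forall>\<^sub>F c in F. Q' c a"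
  shows "\<forall>\<^sub>F c in F. alternates (P' c) (Q' c) s n e"
  using assms(1)
proof (induction n arbitrary: e)
  case (Suc n)
  then obtain a where a: "a \<le> e" "alternates P Q s n a" "if even n then P a else Q a"
    by auto
  have "\<forall>\<^sub>F c in F. if even n then P' c a else Q' c a"
    using a(3) P Q alternates_ge[OF a(2)] by (auto split: if_splits)
  with Suc.IH[OF a(2)] show ?case
    by eventually_elim (use a(1) in auto)
qed auto

section \<open>Passage times and chains\<close>

primrec passage_time :: "(real \<Rightarrow> bool) \<Rightarrow> (real \<Rightarrow> bool) \<Rightarrow> real \<Rightarrow> real \<Rightarrow> nat \<Rightarrow> ereal" where
  "passage_time P Q s t 0 = ereal s"
| "passage_time P Q s t (Suc n) = first_time (if even n then P else Q) (passage_time P Q s t n) t"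

text \<open>The even passage times are the \<open>\<sigma>\<close> of the interval crossings, the odd ones the \<open>\<tau>\<close>.\<close>

lemma down_time_eq_passage_time:
  "down_time y c x s t n = passage_time (\<lambda>u. x u \<ge> y + c / 2) (\<lambda>u. x u < y - c / 2) s t (2 * n)"
  by (induction n) (auto simp: Let_def)

text \<open>First times are greedy, so none comes later than the matching point of any
  chain.\<close>

lemma passage_time_le:
  assumes "alternates P Q s n e" "e \<le> t"
  shows "passage_time P Q s t n \<le> ereal e"
  using assms
proof (induction n arbitrary: e)
  case (Suc n)
  then obtain a where a: "a \<le> e" "alternates P Q s n a" "if even n then P a else Q a"
    by auto
  then have "passage_time P Q s t n \<le> ereal a"
    using Suc by auto
  then have "passage_time P Q s t (Suc n) \<le> ereal a"
    unfolding passage_time.simps first_time_def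
    by (intro INF_lower) (use a Suc in auto)
  then show ?case
    using a(1) by (meson ereal_less_eq(3) order_trans)
qed auto

lemma first_time_lessD:
  assumes "first_time P a t < e"
  obtains u where "a \<le> ereal u" "u \<le> t" "P u" "ereal u < e"
  using assms unfolding first_time_def INF_less_iff by auto

text \<open>A passage time may be an unattained infimum. The strict bound leaves room: some
  \<open>a < e\<close> has the right predicate, and \<open>P'\<close> or \<open>Q'\<close> still
  holds slightly to the right of \<open>a\<close>. Moving there also puts the previous passage time
  strictly before the new point, as the induction hypothesis requires. The first conjunct keeps
  \<open>a\<close> where the one-sided assumptions apply.\<close>

lemma alternates_if_passage_time_less:
  assumes "passage_time P Q s t n < ereal e" "e \<le> t"
    and P: "\<And>a. s \<le> a \<Longrightarrow> a < t \<Longrightarrow> P a \<Longrightarrow> \<forall>\<^sub>F u in at_right a. P' u"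
    and Q: "\<And>a. s \<le> a \<Longrightarrow> a < t \<Longrightarrow> Q a \<Longrightarrow> \<forall>\<^sub>F u in at_right a. Q' u"
  shows "ereal s \<le> passage_time P Q s t n \<and> alternates P' Q' s n e"
  using assms(1,2)
proof (induction n arbitrary: e)
  case (Suc n)
  let ?S = "if even n then P else Q"
  have lt: "first_time ?S (passage_time P Q s t n) t < ereal e"
    using Suc.prems by simp
  from first_time_lessD[OF this] obtain a
    where a: "passage_time P Q s t n \<le> ereal a" "a \<le> t" "?S a" "a < e"
    by auto
  have "passage_time P Q s t n < ereal e"
    using a by (meson ereal_less_eq(3) leD le_less_trans less_ereal.simps(1))
  then have ge: "ereal s \<le> passage_time P Q s t n"
    using Suc.IH Suc.prems(2) by auto
  have sa: "s \<le> a"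
    using ge a(1) by (meson ereal_less_eq(3) order_trans)
  have "\<forall>\<^sub>F u in at_right a. if even n then P' u else Q' u"
    using P[OF sa] Q[OF sa] a Suc.prems(2) by (auto split: if_splits)
  moreover have "\<forall>\<^sub>F u in at_right a. a < u \<and> u < e"
    using a(4) by (simp add: eventually_at_right_less eventually_conj eventually_at_right_field) blast
  ultimately have "\<exists>u. (if even n then P' u else Q' u) \<and> a < u \<and> u < e"
    by (intro eventually_happens'[where F = "at_right a"]) (auto elim: eventually_elim2)
  then obtain u where u: "if even n then P' u else Q' u" "a < u" "u < e"
    by blast
  have "passage_time P Q s t n < ereal u"
    using a(1) u(2) by (meson le_less_trans less_ereal.simps(1))
  then have "alternates P' Q' s n u"
    using Suc.IH u(3) Suc.prems(2) by auto
  moreover have "ereal s \<le> passage_time P Q s t (Suc n)"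
    unfolding passage_time.simps first_time_def
    by (intro INF_greatest) (use ge order_trans in blast)
  ultimately show ?case
    using u by (auto intro!: exI[of _ u])
qed auto

text \<open>At the endpoint \<open>t\<close> no room is left on the right. But a passage time equal
  to \<open>t\<close> is attained there, being an infimum of times that are at most
  \<open>t\<close>, and two successive ones cannot both equal \<open>t\<close> because
  \<open>P\<close> and \<open>Q\<close> exclude each other at \<open>t\<close>. So \<open>t\<close>
  itself completes a chain obtained from the strict case.\<close>

lemma alternates_if_passage_time_le:
  assumes "passage_time P Q s t n \<le> ereal t" "s < t"
    and P: "\<And>a. s \<le> a \<Longrightarrow> a < t \<Longrightarrow> P a \<Longrightarrow> \<forall>\<^sub>F u in at_right a. P' u" "\<And>a. P a \<Longrightarrow> P' a"
    and Q: "\<And>a. s \<le> a \<Longrightarrow> a < t \<Longrightarrow> Q a \<Longrightarrow> \<forall>\<^sub>F u in at_right a. Q' u" "\<And>a. Q a \<Longrightarrow> Q' a"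
    and PQ: "\<not> (P t \<and> Q t)"
  shows "alternates P' Q' s n t"
proof (cases "passage_time P Q s t n < ereal t")
  case True
  then show ?thesis
    using alternates_if_passage_time_less[OF True order.refl] P Q by blast
next
  case False
  then have eq: "passage_time P Q s t n = ereal t"
    using assms(1) by auto
  then obtain m where m: "n = Suc m"
    using assms(2) by (cases n) auto
  let ?S = "if even m then P else Q"
  have ft: "first_time ?S (passage_time P Q s t m) t = ereal t"
    using eq m by simp
  then have "first_time ?S (passage_time P Q s t m) t < \<infinity>"
    by simp
  from first_time_lessD[OF this] obtain u
    where u: "passage_time P Q s t m \<le> ereal u" "u \<le> t" "?S u"
    by auto
  have "first_time ?S (passage_time P Q s t m) t \<le> ereal u"
    unfolding first_time_def by (intro INF_lower) (use u in auto)
  with ft u have "u = t" by auto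
  with u have ut: "passage_time P Q s t m \<le> ereal t" "?S t" by auto
  have "passage_time P Q s t m \<noteq> ereal t"
  proof
    assume eq': "passage_time P Q s t m = ereal t"
    then obtain k where k: "m = Suc k"
      using assms(2) by (cases m) auto
    let ?R = "if even k then P else Q"
    have ft: "first_time ?R (passage_time P Q s t k) t = ereal t"
      using eq' k by simp
    then have "first_time ?R (passage_time P Q s t k) t < \<infinity>"
      by simp
    from first_time_lessD[OF this] obtain v
      where v: "passage_time P Q s t k \<le> ereal v" "v \<le> t" "?R v"
      by auto
    have "first_time ?R (passage_time P Q s t k) t \<le> ereal v"
      unfolding first_time_def by (intro INF_lower) (use v in auto)
    with ft v have "v = t" by auto
    then show False
      using v(3) ut(2) k PQ by (auto split: if_splits)
  qed
  then have "passage_time P Q s t m < ereal t"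
    using ut by auto
  then have "alternates P' Q' s m t"
    using alternates_if_passage_time_less[OF _ order.refl] P Q by blast
  then show ?thesis
    using ut(2) P(2) Q(2) unfolding m by (auto split: if_splits)
qed

text \<open>For every \<open>c > 0\<close> passage times of the interval yield a chain around
  \<open>z\<close>, so the count is at most \<open>L div 2\<close>. Conversely, a single chain of
  length \<open>L\<close> clears the margin \<open>c / 2\<close> for all small \<open>c\<close>.
  Hence the count is constant near 0; one downcrossing uses two passage times.\<close>

lemma level_down_eq:
  assumes x: "cadlag x" and t: "0 < t"
    and L: "\<And>n. alternates (\<lambda>u. x u > z) (\<lambda>u. x u < z) 0 n t \<longleftrightarrow> n \<le> L"
  shows "level_down z x 0 t = enat (L div 2)"
proof -
  define P where "P c u \<longleftrightarrow> x u \<ge> z + c / 2" for c u :: real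
  define Q where "Q c u \<longleftrightarrow> x u < z - c / 2" for c u :: real
  have lim: "(x \<longlongrightarrow> x a) (at_right a)" if "0 \<le> a" for a
    using x that by (auto simp: cadlag_def)
  have c_to_P: "\<forall>\<^sub>F c in at_right 0. P c a" if "x a > z" for a
    unfolding eventually_at_right_field P_def
    by (rule exI[of _ "2 * (x a - z)"]) (use that in auto)
  have c_to_Q: "\<forall>\<^sub>F c in at_right 0. Q c a" if "x a < z" for a
    unfolding eventually_at_right_field Q_def
    by (rule exI[of _ "2 * (z - x a)"]) (use that in auto)
  have "alternates (\<lambda>u. x u > z) (\<lambda>u. x u < z) 0 L t"
    using L by simp
  then have "\<forall>\<^sub>F c in at_right 0. alternates (P c) (Q c) 0 L t"
    by (rule eventually_alternates) (use c_to_P c_to_Q in auto)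
  moreover have "\<forall>\<^sub>F c in at_right (0::real). 0 < c"
    by (rule eventually_at_right_less)
  ultimately have "\<forall>\<^sub>F c in at_right 0. enat (downcrossings z c x 0 t) = enat (L div 2)"
  proof eventually_elim
    case (elim c)
    have "down_time z c x 0 t n \<le> ereal t \<longleftrightarrow> n \<le> L div 2" for n
    proof
      assume "down_time z c x 0 t n \<le> ereal t"
      then have *: "passage_time (P c) (Q c) 0 t (2 * n) \<le> ereal t"
        by (simp add: down_time_eq_passage_time P_def[abs_def] Q_def[abs_def])
      have "alternates (\<lambda>u. x u > z) (\<lambda>u. x u < z) 0 (2 * n) t"
      proof (rule alternates_if_passage_time_le[OF * t])
        show "\<forall>\<^sub>F u in at_right a. z < x u" if "0 \<le> a" "P c a" for a
          using order_tendstoD(1)[OF lim[OF that(1)]] that(2) elim(2) by (auto simp: P_def)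
        show "\<forall>\<^sub>F u in at_right a. x u < z" if "0 \<le> a" "Q c a" for a
          using order_tendstoD(2)[OF lim[OF that(1)]] that(2) elim(2) by (auto simp: Q_def)
      qed (use elim(2) in \<open>auto simp: P_def Q_def\<close>)
      then show "n \<le> L div 2"
        using L by auto
    next
      assume "n \<le> L div 2"
      then have "2 * n \<le> L" by auto
      with elim(1) have "alternates (P c) (Q c) 0 (2 * n) t"
        by (rule alternates_antimono)
      then have "passage_time (P c) (Q c) 0 t (2 * n) \<le> ereal t"
        by (rule passage_time_le) simp
      then show "down_time z c x 0 t n \<le> ereal t"
        by (simp add: down_time_eq_passage_time P_def[abs_def] Q_def[abs_def])
    qed
    then have "{n. down_time z c x 0 t n \<le> ereal t} = {..L div 2}"
      by auto
    then show ?case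
      unfolding downcrossings_def by (simp add: Max_eq_iff)
  qed
  then show ?thesis
    unfolding level_down_def by (intro tendsto_Lim tendsto_eventually) auto
qed

lemma level_up_eq_level_down: "level_up z x s t = level_down (- z) (\<lambda>u. - x u) s t"
  by (simp add: level_up_def level_down_def upcrossings_def)

lemma level_up_eq:
  assumes x: "cadlag x" and t: "0 < t"
    and L: "\<And>n. alternates (\<lambda>u. x u < z) (\<lambda>u. x u > z) 0 n t \<longleftrightarrow> n \<le> L"
  shows "level_up z x 0 t = enat (L div 2)"
  unfolding level_up_eq_level_down
proof (rule level_down_eq[OF _ t])
  show "cadlag (\<lambda>u. - x u)"
    using x unfolding cadlag_def by (metis tendsto_minus)
qed (simp add: L)

lemma alternates_length:
  assumes "\<not> alternates P Q s N t" "s \<le> t"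
  obtains L where "\<And>n. alternates P Q s n t \<longleftrightarrow> n \<le> L"
proof -
  have bd: "n \<le> N" if "alternates P Q s n t" for n
    using assms(1) alternates_antimono[OF that] by (meson linear)
  let ?L = "GREATEST n. alternates P Q s n t"
  have "alternates P Q s ?L t"
    by (rule GreatestI_nat[of _ 0 N]) (use assms(2) bd in auto)
  then have "alternates P Q s n t \<longleftrightarrow> n \<le> ?L" for n
    using alternates_antimono Greatest_le_nat[of "\<lambda>n. alternates P Q s n t" n N] bd by blast
  then show ?thesis by (rule that)
qed

lemma level_crossings_of_alternates_bounded:
  assumes x: "cadlag x" and t: "0 < t" and "x 0 \<noteq> z" "x t \<noteq> z"
    and N: "\<not> alternates (\<lambda>u. x u > z) (\<lambda>u. x u < z) 0 N t"
  shows "level_up z x 0 t \<noteq> \<infinity>" "level_down z x 0 t \<noteq> \<infinity>"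
    "net_crossings z x 0 t = of_bool (x t > z) - of_bool (x 0 > z)"
proof -
  define hi where "hi u \<longleftrightarrow> x u > z" for u
  define lo where "lo u \<longleftrightarrow> x u < z" for u
  have N': "\<not> alternates hi lo 0 N t"
    using N by (simp add: hi_def[abs_def] lo_def[abs_def])
  then have "\<not> alternates lo hi 0 (Suc N) t"
    using alternates_drop by blast
  then obtain L' where L': "\<And>n. alternates lo hi 0 n t \<longleftrightarrow> n \<le> L'"
    using alternates_length t by (metis less_imp_le)
  obtain L where L: "\<And>n. alternates hi lo 0 n t \<longleftrightarrow> n \<le> L"
    using alternates_length[OF N'] t by (metis less_imp_le)
  have up: "level_up z x 0 t = enat (L' div 2)"
    by (rule level_up_eq[OF x t]) (use L' in \<open>simp add: hi_def[abs_def] lo_def[abs_def]\<close>)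
  have down: "level_down z x 0 t = enat (L div 2)"
    by (rule level_down_eq[OF x t]) (use L in \<open>simp add: hi_def[abs_def] lo_def[abs_def]\<close>)
  show "level_up z x 0 t \<noteq> \<infinity>" "level_down z x 0 t \<noteq> \<infinity>"
    by (simp_all add: up down)
  \<comment> \<open>Deleting the first point of a chain exchanges the roles of \<open>hi\<close> and
    \<open>lo\<close>.\<close>
  have "L' \<le> Suc L" "L \<le> Suc L'"
    using alternates_drop[of lo hi 0 "L' - 1" t] alternates_drop[of hi lo 0 "L - 1" t] L L'
    by (cases L'; cases L; simp del: alternates.simps(2))+
  \<comment> \<open>Time 0 can be put in front of a maximal chain that starts on the other side, so
    the side of \<open>x 0\<close> decides which length is larger.\<close>
  have hi0: "Suc L' \<le> L" if "hi 0"
    using alternates_prepend[of hi 0 0 lo L' t] that L L' by blast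
  have lo0: "Suc L \<le> L'" if "lo 0"
    using alternates_prepend[of lo 0 0 hi L t] that L L' by blast
  \<comment> \<open>A maximal chain cannot be extended by \<open>t\<close>; hence its parity encodes
    the side of \<open>x t\<close>.\<close>
  have 1: "\<not> (if even L then hi t else lo t)"
    using alternates_append[of hi lo 0 L t t] L Suc_n_not_le_n by blast
  have 2: "\<not> (if even L' then lo t else hi t)"
    using alternates_append[of lo hi 0 L' t t] L' Suc_n_not_le_n by blast
  have net: "net_crossings z x 0 t = real (L' div 2) - real (L div 2)"
    by (simp add: net_crossings_def up down)
  consider "hi 0" "L = Suc L'" | "lo 0" "L' = Suc L"
    using hi0 lo0 \<open>L' \<le> Suc L\<close> \<open>L \<le> Suc L'\<close> assms(3) unfolding hi_def lo_def
    by (metis le_antisym linorder_neqE_linordered_idom)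
  then show "net_crossings z x 0 t = of_bool (x t > z) - of_bool (x 0 > z)"
  proof cases
    case 1
    show ?thesis
      using 1 2 assms(4) unfolding net hi_def lo_def
      by (cases "even L'") (auto elim!: evenE oddE)
  next
    case 2
    then show ?thesis
      using 1 assms(4) unfolding net hi_def lo_def
      by (cases "even L") (auto elim!: evenE oddE)
  qed
qed

subsection \<open>Almost every level is crossed finitely often\<close>

lemma sign_change_in_segment:
  fixes y :: "nat \<Rightarrow> real"
  assumes "i \<le> j" and "z < y i \<and> y j < z \<or> y i < z \<and> z < y j"
  shows "\<exists>k. i \<le> k \<and> k < j \<and> z \<in> closed_segment (y k) (y (Suc k))"
proof (rule ccontr)
  assume *: "\<not> ?thesis"
  have "(z < y i \<longrightarrow> z < y j) \<and> (y i < z \<longrightarrow> y j < z)"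
    using assms(1) *
  proof (induction j rule: dec_induct)
    case (step k)
    have "z \<notin> closed_segment (y k) (y (Suc k))"
      using step.prems step.hyps by auto
    then show ?case
      using step by (fastforce simp: closed_segment_eq_real_ivl split: if_splits)
  qed auto
  with assms(2) show False by auto
qed

text \<open>Between two successive chain points \<open>y\<close> changes side, so some segment in
  that index range contains \<open>z\<close>. Recording the last point \<open>a\<close> and counting
  only indices below \<open>k a\<close> makes the next segment a new one, because \<open>k\<close>
  is monotone.\<close>

lemma alternates_le_card_segments:
  fixes k :: "real \<Rightarrow> nat" and y :: "nat \<Rightarrow> real"
  assumes "mono k"
    and "alternates (\<lambda>a. y (k a) > z) (\<lambda>a. y (k a) < z) s (Suc n) e"
  shows "\<exists>a\<le>e. (if even n then y (k a) > z else y (k a) < z) \<and>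
           n \<le> card {i. i < k a \<and> z \<in> closed_segment (y i) (y (Suc i))}"
  using assms(2)
proof (induction n arbitrary: e)
  case 0
  then show ?case by auto
next
  case (Suc n)
  then obtain b where b: "b \<le> e" "alternates (\<lambda>a. y (k a) > z) (\<lambda>a. y (k a) < z) s (Suc n) b"
    "if even (Suc n) then y (k b) > z else y (k b) < z"
    unfolding alternates.simps(2)[of _ _ _ "Suc n"] by auto
  from Suc.IH[OF b(2)] obtain a where a: "a \<le> b" "if even n then y (k a) > z else y (k a) < z"
    "n \<le> card {i. i < k a \<and> z \<in> closed_segment (y i) (y (Suc i))}"
    by auto
  have "k a \<le> k b"
    using assms(1) a(1) by (auto dest: monoD)
  moreover have "z < y (k a) \<and> y (k b) < z \<or> y (k a) < z \<and> z < y (k b)"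
    using a(2) b(3) by (auto split: if_splits)
  ultimately obtain i where i: "k a \<le> i" "i < k b" "z \<in> closed_segment (y i) (y (Suc i))"
    using sign_change_in_segment by blast
  have "Suc n \<le> card (insert i {i. i < k a \<and> z \<in> closed_segment (y i) (y (Suc i))})"
    using a(3) i(1) by (subst card_insert_disjoint) auto
  also have "\<dots> \<le> card {i. i < k b \<and> z \<in> closed_segment (y i) (y (Suc i))}"
    by (rule card_mono) (use i \<open>k a \<le> k b\<close> in auto)
  finally show ?case
    using b by (intro exI[of _ b]) auto
qed

text \<open>The number of sign changes of \<open>x - z\<close> along a uniform grid integrates over \<open>z\<close> to a variation
  sum of \<open>x\<close>, and every alternation of \<open>x\<close> around \<open>z\<close> is seen by all fine grids, so that Fatou's
  lemma applies.\<close>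

lemma AE_alternates_bounded:
  assumes x: "cadlag x" and t: "0 < t" and tv: "total_variation x 0 t < \<infinity>"
  shows "AE z in lborel. \<exists>N. \<not> alternates (\<lambda>u. x u > z) (\<lambda>u. x u < z) 0 N t"
proof -
  define p where "p m i = real i * t / real (Suc m)" for m i
  define F :: "nat \<Rightarrow> real \<Rightarrow> ennreal" where
    "F m z = (\<Sum>i<Suc m. indicator (closed_segment (x (p m i)) (x (p m (Suc i)))) z)" for m z
  have emeasure_seg: "emeasure lborel (closed_segment a b) = ennreal \<bar>b - a\<bar>" for a b :: real
    by (auto simp: closed_segment_eq_real_ivl)
  have F_meas: "F m \<in> borel_measurable lborel" for m
    unfolding F_def by measurable
  have F_int: "(\<integral>\<^sup>+z. F m z \<partial>lborel) \<le> total_variation x 0 t" for m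
  proof -
    have "(\<integral>\<^sup>+z. F m z \<partial>lborel) = ennreal (\<Sum>i<Suc m. \<bar>x (p m (Suc i)) - x (p m i)\<bar>)"
      unfolding F_def
      by (subst nn_integral_sum) (simp_all add: emeasure_seg sum_ennreal del: sum.lessThan_Suc)
    also have "\<dots> \<le> total_variation x 0 t"
      unfolding total_variation_def
    proof (rule SUP_upper2[of "(Suc m, p m)"])
      show "(Suc m, p m) \<in> {(n, p). p 0 = 0 \<and> p n = t \<and> (\<forall>i<n. p i \<le> p (Suc i))}"
        using t by (auto simp: p_def divide_right_mono)
    qed simp
    finally show ?thesis .
  qed
  have "(\<integral>\<^sup>+z. liminf (\<lambda>m. F m z) \<partial>lborel) \<le> liminf (\<lambda>m. \<integral>\<^sup>+z. F m z \<partial>lborel)"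
    by (rule nn_integral_liminf) (rule F_meas)
  also have "\<dots> \<le> total_variation x 0 t"
    by (rule order_trans[OF Liminf_mono[of _ "\<lambda>_. total_variation x 0 t"]])
      (auto simp: F_int Liminf_const)
  finally have "(\<integral>\<^sup>+z. liminf (\<lambda>m. F m z) \<partial>lborel) \<noteq> \<infinity>"
    using tv by (auto simp: top_unique)
  then have "AE z in lborel. liminf (\<lambda>m. F m z) \<noteq> \<infinity>"
    using F_meas by (intro nn_integral_PInf_AE) auto
  then show ?thesis
  proof (rule AE_mp, intro AE_I2 impI)
    fix z assume fin: "liminf (\<lambda>m. F m z) \<noteq> \<infinity>"
    show "\<exists>N. \<not> alternates (\<lambda>u. x u > z) (\<lambda>u. x u < z) 0 N t"
    proof (rule ccontr)
      assume "\<not> ?thesis"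
      then have alt: "alternates (\<lambda>u. x u > z) (\<lambda>u. x u < z) 0 N t" for N
        by blast
      \<comment> \<open>Index of the first grid point at or after \<open>a\<close>. Rounding upwards
        makes the sampled values approach \<open>x a\<close> from the right, where \<open>x\<close>
        is continuous; \<open>k m t = Suc m\<close> keeps the counted segments among those of
        \<open>F m\<close>.\<close>
      define k where "k m a = nat \<lceil>a * real (Suc m) / t\<rceil>" for m a
      have k_mono: "mono (k m)" for m
        unfolding k_def using t
        by (intro monoI nat_mono ceiling_mono divide_right_mono mult_right_mono) auto
      have k_t: "k m t = Suc m" for m
      proof -
        have "t * real (Suc m) / t = of_int (int (Suc m))"
          using t by simp
        then show ?thesis
          unfolding k_def by (metis ceiling_of_int nat_int)
      qed
      have k_ge: "a \<le> p m (k m a)" and k_le: "p m (k m a) < a + t / real (Suc m)"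
        if "0 \<le> a" for m a
      proof -
        let ?w = "a * real (Suc m) / t"
        have "0 \<le> ?w" using t that by auto
        then have r: "real (k m a) = of_int \<lceil>?w\<rceil>"
          unfolding k_def by (simp add: ceiling_mono)
        have "?w \<le> real (k m a)" "real (k m a) < ?w + 1"
          unfolding r by linarith+
        moreover have "?w * t / real (Suc m) = a" "(?w + 1) * t / real (Suc m) = a + t / real (Suc m)"
          using t by (auto simp: add_divide_distrib distrib_right)
        moreover have "?w * t / real (Suc m) \<le> real (k m a) * t / real (Suc m)"
          using t calculation(1) by (intro divide_right_mono mult_right_mono) auto
        moreover have "real (k m a) * t / real (Suc m) < (?w + 1) * t / real (Suc m)"
          using t calculation(2) by (intro divide_strict_right_mono mult_strict_right_mono) auto
        ultimately show "a \<le> p m (k m a)" "p m (k m a) < a + t / real (Suc m)"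
          unfolding p_def by argo+
      qed
      have ev: "\<forall>\<^sub>F m in sequentially. R (x (p m (k m a)))"
        if a: "0 \<le> a" "R (x a)" and R: "\<forall>\<^sub>F u in at_right a. R (x u)" for a R
      proof -
        obtain d where d: "d > a" "\<And>u. a < u \<Longrightarrow> u < d \<Longrightarrow> R (x u)"
          using R unfolding eventually_at_right_field by auto
        have "(\<lambda>m. a + t / real (Suc m)) \<longlonglongrightarrow> a + 0"
          by (intro tendsto_add tendsto_const LIMSEQ_Suc lim_const_over_n)
        then have "\<forall>\<^sub>F m in sequentially. a + t / real (Suc m) < d"
          using d(1) by (intro order_tendstoD(2)) auto
        then show ?thesis
        proof eventually_elim
          case (elim m)
          then have "p m (k m a) < d" "a \<le> p m (k m a)"
            using k_ge[OF a(1), of m] k_le[OF a(1), of m] by auto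
          then show ?case
            using d(2)[of "p m (k m a)"] a(2) by (cases "p m (k m a) = a") auto
        qed
      qed
      have lim: "(x \<longlongrightarrow> x a) (at_right a)" if "0 \<le> a" for a
        using x that by (auto simp: cadlag_def)
      have bound: "of_nat n \<le> liminf (\<lambda>m. F m z)" for n
      proof (rule Liminf_bounded)
        have "\<forall>\<^sub>F m in sequentially.
            alternates (\<lambda>a. x (p m (k m a)) > z) (\<lambda>a. x (p m (k m a)) < z) 0 (Suc n) t"
          by (rule eventually_alternates[OF alt])
            (auto intro!: ev order_tendstoD[OF lim])
        then show "\<forall>\<^sub>F m in sequentially. of_nat n \<le> F m z"
        proof eventually_elim
          case (elim m)
          from alternates_le_card_segments[OF k_mono this] obtain a where
            "a \<le> t" "n \<le> card {i. i < k m a \<and> z \<in> closed_segment (x (p m i)) (x (p m (Suc i)))}"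
            by auto
          note this(2)
          also have "card {i. i < k m a \<and> z \<in> closed_segment (x (p m i)) (x (p m (Suc i)))} \<le>
              card {i. i < Suc m \<and> z \<in> closed_segment (x (p m i)) (x (p m (Suc i)))}"
            using monoD[OF k_mono \<open>a \<le> t\<close>, of m] by (intro card_mono) (auto simp: k_t)
          finally have "of_nat n \<le>
              (of_nat (card {i. i < Suc m \<and> z \<in> closed_segment (x (p m i)) (x (p m (Suc i)))})
                :: ennreal)"
            by simp
          also have "\<dots> = F m z"
            unfolding F_def
            by (simp add: indicator_def sum.If_cases Int_def lessThan_def del: sum.lessThan_Suc)
          finally show ?case .
        qed
      qed
      obtain n where "liminf (\<lambda>m. F m z) < of_nat n"
        using fin ennreal_Ex_less_of_nat[of "liminf (\<lambda>m. F m z)"] by (auto simp: top.not_eq_extremum)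
      with bound[of n] show False by simp
    qed
  qed
qed

subsection \<open>Sign changes at a generic level\<close>

text \<open>The chain is built forwards: visits to both sides recur arbitrarily close to
  \<open>s\<close>, so a next point is always available after those already chosen and still before
  \<open>s\<close>.\<close>

lemma alternates_if_frequently_left:
  assumes "\<exists>\<^sub>F u in at_left s. P u" "\<exists>\<^sub>F u in at_left s. Q u" "r < s"
  shows "\<exists>e<s. alternates P Q r n e"
proof (induction n)
  case 0
  then show ?case using assms(3) by auto
next
  case (Suc n)
  then obtain e where e: "e < s" "alternates P Q r n e" by blast
  have "\<exists>\<^sub>F u in at_left s. if even n then P u else Q u"
    using assms by (cases "even n") auto
  moreover have "\<forall>\<^sub>F u in at_left s. e < u \<and> u < s"
    using e(1) by (auto simp: eventually_at_left_field)
  ultimately obtain u where u: "if even n then P u else Q u" "e < u" "u < s"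
    using frequently_eventually_conj[of "\<lambda>u. if even n then P u else Q u" "at_left s"
      "\<lambda>u. e < u \<and> u < s"] by (auto dest: frequently_ex)
  have "alternates P Q r (Suc n) u"
    by (rule alternates_append[OF alternates_mono_end[OF e(2)] u(1)]) (use u in auto)
  with u(3) show ?case by blast
qed

text \<open>Mirror image, built backwards: a new first point is put between \<open>s\<close> and the
  chain, which swaps \<open>P\<close> and \<open>Q\<close>; hence the generalisation over
  both.\<close>

lemma alternates_if_frequently_right:
  assumes "\<exists>\<^sub>F u in at_right s. P u" "\<exists>\<^sub>F u in at_right s. Q u" "s < e"
  shows "\<exists>r>s. alternates P Q r n e"
  using assms
proof (induction n arbitrary: P Q)
  case 0
  then show ?case by auto
next
  case (Suc n)
  then obtain r where r: "r > s" "alternates Q P r n e" by blast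
  have "\<forall>\<^sub>F u in at_right s. s < u \<and> u < r"
    using r(1) by (auto simp: eventually_at_right_field)
  from frequently_eventually_conj[OF Suc.prems(1) this]
  obtain u where u: "P u" "s < u" "u < r"
    by (auto dest: frequently_ex)
  have "alternates P Q u (Suc n) e"
    by (rule alternates_prepend[OF u(1) order.refl alternates_mono_start[OF r(2)]]) (use u in simp)
  with u(2) show ?case by blast
qed

section \<open>One-sided limits of cadlag paths\<close>

lemma eventually_at_left_less: "\<forall>\<^sub>F u in at_left s. u < (s::real)"
  by (simp add: eventually_at_filter)

lemma cadlag_at_right: "cadlag x \<Longrightarrow> 0 \<le> s \<Longrightarrow> (x \<longlongrightarrow> x s) (at_right s)"
  by (auto simp: cadlag_def)

lemma cadlag_at_left:
  assumes "cadlag x" "0 < s"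
  shows "(x \<longlongrightarrow> left_lim x s) (at_left s)"
  using assms unfolding cadlag_def left_lim_def by (metis tendsto_Lim trivial_limit_at_left_real)

lemma cadlag_isCont_iff:
  assumes "cadlag x" "0 < s"
  shows "isCont x s \<longleftrightarrow> jump x s = 0"
proof -
  have "isCont x s \<longleftrightarrow> (x \<longlongrightarrow> x s) (at_left s)"
    using cadlag_at_right[of x s] assms by (simp add: isCont_def filterlim_at_split)
  also have "\<dots> \<longleftrightarrow> jump x s = 0"
    using cadlag_at_left[OF assms] tendsto_unique[of "at_left s" x]
    by (auto simp: jump_def)
  finally show ?thesis .
qed

text \<open>\<open>endpoints\<close> gives the path a definite side at 0 and \<open>t\<close>,
  \<open>not_jump_value\<close> turns weak inequalities at a jump into strict ones,
  \<open>not_extremum\<close> does so on whole intervals, and \<open>alternates_bounded\<close>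
  forbids oscillation around the level.\<close>

locale generic_level =
  fixes x :: "real \<Rightarrow> real" and t z :: real
  assumes cadlag: "cadlag x" and t_pos: "0 < t"
    and endpoints: "x 0 \<noteq> z" "x t \<noteq> z"
    and not_jump_value: "\<And>s. 0 < s \<Longrightarrow> s \<le> t \<Longrightarrow> jump x s \<noteq> 0 \<Longrightarrow> x s \<noteq> z \<and> left_lim x s \<noteq> z"
    and not_extremum: "\<And>a s b. 0 \<le> a \<Longrightarrow> a < s \<Longrightarrow> s < b \<Longrightarrow> b \<le> t \<Longrightarrow> x s = z \<Longrightarrow>
        (\<exists>u\<in>{a<..<b}. x u > z) \<and> (\<exists>u\<in>{a<..<b}. x u < z)"
    and alternates_bounded: "\<exists>N. \<not> alternates (\<lambda>u. x u > z) (\<lambda>u. x u < z) 0 N t"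
begin

text \<open>The side just after \<open>s\<close>, not the side of \<open>x s\<close>: at a
  continuous crossing \<open>x s = z\<close>, but comparing \<open>above_left s\<close> with
  \<open>above s\<close> still detects the change.\<close>

definition above :: "real \<Rightarrow> bool" where
  "above s \<longleftrightarrow> (\<forall>\<^sub>F u in at_right s. x u > z)"

definition above_left :: "real \<Rightarrow> bool" where
  "above_left s \<longleftrightarrow> (\<forall>\<^sub>F u in at_left s. x u > z)"

text \<open>A point of the interval where \<open>x\<close> equals \<open>z\<close> would be a local
  extremum.\<close>

lemma strict_sign_on_interval:
  assumes "0 \<le> a" "b \<le> t"
  shows "(\<forall>u\<in>{a<..<b}. x u \<le> z) \<Longrightarrow> (\<forall>u\<in>{a<..<b}. x u < z)"
    and "(\<forall>u\<in>{a<..<b}. x u \<ge> z) \<Longrightarrow> (\<forall>u\<in>{a<..<b}. x u > z)"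
  using not_extremum[OF assms(1) _ _ assms(2)] by (force simp: order.order_iff_strict)+

text \<open>Frequent visits to both sides just before \<open>s\<close> would produce chains of every
  length. So one side is eventually avoided, and \<open>strict_sign_on_interval\<close> makes the
  remaining inequality strict.\<close>

lemma left_sign:
  assumes "0 < s" "s \<le> t"
  shows "above_left s \<or> (\<forall>\<^sub>F u in at_left s. x u < z)"
proof -
  obtain N where N: "\<not> alternates (\<lambda>u. x u > z) (\<lambda>u. x u < z) 0 N t"
    using alternates_bounded by blast
  have "\<not> ((\<exists>\<^sub>F u in at_left s. x u > z) \<and> (\<exists>\<^sub>F u in at_left s. x u < z))"
    using alternates_if_frequently_left[where s = s and P = "\<lambda>u. x u > z"
        and Q = "\<lambda>u. x u < z" and r = 0 and n = N] N assms
    by (meson alternates_mono_end less_imp_le order_trans)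
  then have "(\<forall>\<^sub>F u in at_left s. x u \<le> z) \<or> (\<forall>\<^sub>F u in at_left s. x u \<ge> z)"
    by (simp add: frequently_def not_less)
  then obtain b where b: "b < s" "(\<forall>u\<in>{b<..<s}. x u \<le> z) \<or> (\<forall>u\<in>{b<..<s}. x u \<ge> z)"
    unfolding eventually_at_left_field by (metis greaterThanLessThan_iff)
  then have "(\<forall>u\<in>{max b 0<..<s}. x u < z) \<or> (\<forall>u\<in>{max b 0<..<s}. x u > z)"
    using strict_sign_on_interval[of "max b 0" s] assms by auto
  then show ?thesis
    unfolding above_left_def eventually_at_left_field
    using b(1) assms by (metis greaterThanLessThan_iff max_less_iff_conj)
qed

lemma right_sign:
  assumes "0 \<le> s" "s \<le> t"
  shows "above s \<or> (\<forall>\<^sub>F u in at_right s. x u < z)"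
proof (cases "x s = z")
  case False
  then show ?thesis
    using order_tendstoD[OF cadlag_at_right[OF cadlag assms(1)], of z]
    unfolding above_def by (meson linorder_neqE_linordered_idom)
next
  case True
  \<comment> \<open>Since the level is attained at \<open>s\<close> but not at \<open>t\<close>,
    there is room to the right of \<open>s\<close> inside [0, t], the range covered by
    \<open>alternates_bounded\<close> and \<open>not_extremum\<close>.\<close>
  then have "s < t"
    using endpoints assms(2) by (metis order.order_iff_strict)
  obtain N where N: "\<not> alternates (\<lambda>u. x u > z) (\<lambda>u. x u < z) 0 N t"
    using alternates_bounded by blast
  have "\<not> ((\<exists>\<^sub>F u in at_right s. x u > z) \<and> (\<exists>\<^sub>F u in at_right s. x u < z))"
    using alternates_if_frequently_right[where s = s and P = "\<lambda>u. x u > z"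
        and Q = "\<lambda>u. x u < z" and e = t and n = N] N assms \<open>s < t\<close>
    by (meson alternates_mono_start less_imp_le order_trans)
  then have "(\<forall>\<^sub>F u in at_right s. x u \<le> z) \<or> (\<forall>\<^sub>F u in at_right s. x u \<ge> z)"
    by (simp add: frequently_def not_less)
  then obtain b where b: "b > s" "(\<forall>u\<in>{s<..<b}. x u \<le> z) \<or> (\<forall>u\<in>{s<..<b}. x u \<ge> z)"
    unfolding eventually_at_right_field by (metis greaterThanLessThan_iff)
  then have "(\<forall>u\<in>{s<..<min b t}. x u < z) \<or> (\<forall>u\<in>{s<..<min b t}. x u > z)"
    using strict_sign_on_interval[of s "min b t"] assms by auto
  then show ?thesis
    unfolding above_def eventually_at_right_field
    using b(1) \<open>s < t\<close> by (metis greaterThanLessThan_iff min_less_iff_conj)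
qed

lemma not_above:
  assumes "\<forall>\<^sub>F u in at_right s. x u < z"
  shows "\<not> above s"
proof
  assume "above s"
  then have "\<forall>\<^sub>F u in at_right s. False"
    using assms unfolding above_def by eventually_elim auto
  then show False by simp
qed

lemma not_above_left:
  assumes "\<forall>\<^sub>F u in at_left s. x u < z"
  shows "\<not> above_left s"
proof
  assume "above_left s"
  then have "\<forall>\<^sub>F u in at_left s. False"
    using assms unfolding above_left_def by eventually_elim auto
  then show False by simp
qed

lemma above_if_sign_on_interval:
  assumes "u \<in> {a<..<b}"
  shows "(\<forall>v\<in>{a<..<b}. x v > z) \<Longrightarrow> above u \<and> above_left u"
    and "(\<forall>v\<in>{a<..<b}. x v < z) \<Longrightarrow> \<not> above u \<and> \<not> above_left u"
proof -
  have ev: "\<forall>\<^sub>F v in at_right u. v \<in> {a<..<b}" "\<forall>\<^sub>F v in at_left u. v \<in> {a<..<b}"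
    using assms unfolding eventually_at_right_field eventually_at_left_field
    by (auto intro: exI[of _ a] exI[of _ b])
  show "(\<forall>v\<in>{a<..<b}. x v > z) \<Longrightarrow> above u \<and> above_left u"
    unfolding above_def above_left_def using ev by (auto elim: eventually_mono)
  show "(\<forall>v\<in>{a<..<b}. x v < z) \<Longrightarrow> \<not> above u \<and> \<not> above_left u"
    using ev by (intro conjI not_above not_above_left) (auto elim: eventually_mono)
qed

lemma right_neighbourhood:
  assumes "0 \<le> s" "s \<le> t"
  shows "\<exists>b>s. \<forall>u\<in>{s<..<b}. (above u \<longleftrightarrow> above s) \<and> (above_left u \<longleftrightarrow> above s)"
  using right_sign[OF assms]
proof
  assume *: "above s"
  then obtain b where "b > s" "\<forall>u\<in>{s<..<b}. x u > z"
    unfolding above_def eventually_at_right_field by auto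
  then show ?thesis
    using above_if_sign_on_interval(1)[of _ s b] * by blast
next
  assume *: "\<forall>\<^sub>F u in at_right s. x u < z"
  then obtain b where "b > s" "\<forall>u\<in>{s<..<b}. x u < z"
    unfolding eventually_at_right_field by auto
  then show ?thesis
    using above_if_sign_on_interval(2)[of _ s b] not_above[OF *] by blast
qed

lemma left_neighbourhood:
  assumes "0 < s" "s \<le> t"
  shows "\<exists>b<s. \<forall>u\<in>{b<..<s}. (above u \<longleftrightarrow> above_left s) \<and> (above_left u \<longleftrightarrow> above_left s)"
  using left_sign[OF assms]
proof
  assume *: "above_left s"
  then obtain b where "b < s" "\<forall>u\<in>{b<..<s}. x u > z"
    unfolding above_left_def eventually_at_left_field by auto
  then show ?thesis
    using above_if_sign_on_interval(1)[of _ b s] * by blast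
next
  assume *: "\<forall>\<^sub>F u in at_left s. x u < z"
  then obtain b where "b < s" "\<forall>u\<in>{b<..<s}. x u < z"
    unfolding eventually_at_left_field by auto
  then show ?thesis
    using above_if_sign_on_interval(2)[of _ b s] not_above_left[OF *] by blast
qed

text \<open>Jumps over the level and continuous passages are counted alike here;
  \<open>ups_eq\<close> separates them.\<close>

definition ups :: "real set" where
  "ups = {s. 0 < s \<and> s \<le> t \<and> \<not> above_left s \<and> above s}"

definition downs :: "real set" where
  "downs = {s. 0 < s \<and> s \<le> t \<and> above_left s \<and> \<not> above s}"

lemma sign_changes_isolated:
  assumes "0 \<le> s" "s \<le> t"
  obtains a b where "a < s" "s < b"
    "\<And>u. s < u \<Longrightarrow> u < b \<Longrightarrow> (above u \<longleftrightarrow> above s) \<and> u \<notin> ups \<and> u \<notin> downs"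
    "\<And>u. a < u \<Longrightarrow> 0 \<le> u \<Longrightarrow> u < s \<Longrightarrow> (above u \<longleftrightarrow> above_left s) \<and> u \<notin> ups \<and> u \<notin> downs"
proof -
  obtain b where b: "s < b" "\<forall>u\<in>{s<..<b}. (above u \<longleftrightarrow> above s) \<and> (above_left u \<longleftrightarrow> above s)"
    using right_neighbourhood[OF assms] by blast
  obtain a where a: "a < s"
    "\<forall>u\<in>{a<..<s}. 0 \<le> u \<longrightarrow> (above u \<longleftrightarrow> above_left s) \<and> (above_left u \<longleftrightarrow> above_left s)"
  proof (cases "s = 0")
    case True
    then show ?thesis using that[of "-1"] by auto
  next
    case False
    then show ?thesis using left_neighbourhood[of s] assms that by force
  qed
  show thesis
    by (rule that[OF a(1) b(1)]) (use a(2) b(2) in \<open>auto simp: ups_def downs_def\<close>)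
qed

text \<open>Infinitely many sign changes in the compact [0, t] would accumulate somewhere, contrary
  to \<open>sign_changes_isolated\<close>.\<close>

lemma finite_sign_changes: "finite ups" "finite downs"
proof -
  have "finite (ups \<union> downs)"
  proof (rule ccontr)
    assume "infinite (ups \<union> downs)"
    moreover have "ups \<union> downs \<subseteq> {0..t}"
      by (auto simp: ups_def downs_def)
    ultimately obtain s where s: "s \<in> {0..t}" "s islimpt (ups \<union> downs)"
      by (meson compact_Icc compact_eq_Bolzano_Weierstrass)
    obtain a b where ab: "a < s" "s < b"
      "\<And>u. s < u \<Longrightarrow> u < b \<Longrightarrow> (above u \<longleftrightarrow> above s) \<and> u \<notin> ups \<and> u \<notin> downs"
      "\<And>u. a < u \<Longrightarrow> 0 \<le> u \<Longrightarrow> u < s \<Longrightarrow> (above u \<longleftrightarrow> above_left s) \<and> u \<notin> ups \<and> u \<notin> downs"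
      using sign_changes_isolated s(1) by (metis atLeastAtMost_iff)
    obtain u where u: "u \<in> ups \<union> downs" "u \<in> {a<..<b}" "u \<noteq> s"
      using s(2) ab(1,2) by (meson greaterThanLessThan_iff islimptE open_greaterThanLessThan)
    then have "0 \<le> u"
      by (auto simp: ups_def downs_def)
    then show False
      using u ab(3,4)[of u] by (cases u s rule: linorder_cases) auto
  qed
  then show "finite ups" "finite downs" by auto
qed

text \<open>The function \<open>f\<close> below, the sign minus the signed count of the changes so far, is locally constant.\<close>

lemma net_sign_changes:
  "real (card ups) - real (card downs) = of_bool (x t > z) - of_bool (x 0 > z)"
proof -
  define f :: "real \<Rightarrow> real" where
    "f u = of_bool (above u) - real (card (ups \<inter> {..u})) + real (card (downs \<inter> {..u}))" for u
  have "f 0 = f t"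
  proof (rule connected_local_const[of "{0..t}" 0 t f])
    show "\<forall>s\<in>{0..t}. \<forall>\<^sub>F u in at s within {0..t}. f s = f u"
    proof
      fix s assume s: "s \<in> {0..t}"
      obtain a b where ab: "a < s" "s < b"
        "\<And>u. s < u \<Longrightarrow> u < b \<Longrightarrow> (above u \<longleftrightarrow> above s) \<and> u \<notin> ups \<and> u \<notin> downs"
        "\<And>u. a < u \<Longrightarrow> 0 \<le> u \<Longrightarrow> u < s \<Longrightarrow> (above u \<longleftrightarrow> above_left s) \<and> u \<notin> ups \<and> u \<notin> downs"
        using sign_changes_isolated s by (metis atLeastAtMost_iff)
      have "f s = f u" if u: "u \<in> {0..t}" "u \<in> {a<..<b}" "u \<noteq> s" for u
      proof (cases "s < u")
        case True
        have "ups \<inter> {..u} = ups \<inter> {..s}" "downs \<inter> {..u} = downs \<inter> {..s}"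
          using ab(3) u True by (auto simp: not_le) (meson le_less_trans not_le)+
        then show ?thesis
          using ab(3)[of u] u True by (simp add: f_def)
      next
        case False
        with u have us: "a < u" "u < s" "0 \<le> u" by auto
        have "r \<le> u" if "r \<in> ups \<union> downs" "r < s" for r
          using ab(4)[of r] that us by (force simp: not_le)
        \<comment> \<open>No sign change lies strictly between \<open>u\<close> and
          \<open>s\<close>, so the counts at \<open>u\<close> and \<open>s\<close> differ at most by
          \<open>s\<close> itself; the step of the indicator from \<open>above_left s\<close> to
          \<open>above s\<close> cancels that difference.\<close>
        then have S: "S \<inter> {..s} = (if s \<in> S then insert s (S \<inter> {..u}) else S \<inter> {..u})"
          if "S \<subseteq> ups \<union> downs" for S
          using that us by (auto simp: subset_iff) (metis UnE order.order_iff_strict)+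
        have "above u \<longleftrightarrow> above_left s"
          using ab(4)[of u] us by blast
        moreover have "s \<in> ups \<longleftrightarrow> \<not> above_left s \<and> above s"
          "s \<in> downs \<longleftrightarrow> above_left s \<and> \<not> above s"
          using s us by (auto simp: ups_def downs_def)
        ultimately show ?thesis
          using us S[of ups] S[of downs] finite_sign_changes by (auto simp: f_def)
      qed
      then show "\<forall>\<^sub>F u in at s within {0..t}. f s = f u"
        unfolding eventually_at_topological using ab(1,2)
        by (intro exI[of _ "{a<..<b}"]) auto
    qed
  qed (use t_pos in auto)
  moreover have "ups \<inter> {..0} = {}" "downs \<inter> {..0} = {}" "ups \<inter> {..t} = ups" "downs \<inter> {..t} = downs"
    by (auto simp: ups_def downs_def)
  moreover have "above s \<longleftrightarrow> x s > z" if "0 \<le> s" "x s \<noteq> z" for s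
    using that order_tendstoD[OF cadlag_at_right[OF cadlag that(1)], of z] not_above[of s]
    unfolding above_def by (meson linorder_neqE_linordered_idom not_less_iff_gr_or_eq)
  ultimately show ?thesis
    using endpoints t_pos by (simp add: f_def)
qed

text \<open>One-sided limits give \<open>left_lim x s \<le> z \<le> x s\<close> at a change. Without
  a jump both sides equal \<open>z\<close>, and the strict signs around \<open>s\<close> are the
  \<open>sgn\<close> condition of \<open>incr_times\<close>; with a jump,
  \<open>not_jump_value\<close> makes both inequalities strict.\<close>

lemma ups_eq:
  "{s \<in> ups. jump x s = 0} = incr_times x z \<inter> {0<..t}"
  "{s \<in> ups. jump x s \<noteq> 0} = {s. 0 < s \<and> s \<le> t \<and> left_lim x s < z \<and> z < x s}"
proof -
  have le: "left_lim x s \<le> z \<and> z \<le> x s" if "s \<in> ups" for s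
  proof
    have s: "0 < s" "s \<le> t" "\<forall>\<^sub>F u in at_left s. x u < z" "\<forall>\<^sub>F u in at_right s. x u > z"
      using that left_sign by (auto simp: ups_def above_def)
    show "left_lim x s \<le> z"
      by (rule tendsto_upperbound[OF cadlag_at_left[OF cadlag s(1)]])
        (use s(3) in \<open>auto elim: eventually_mono\<close>)
    show "z \<le> x s"
      by (rule tendsto_lowerbound[OF cadlag_at_right[OF cadlag]])
        (use s(1,4) in \<open>auto elim: eventually_mono\<close>)
  qed
  have "s \<in> ups \<and> jump x s = 0 \<longleftrightarrow> s \<in> incr_times x z \<inter> {0<..t}" for s
  proof
    assume *: "s \<in> ups \<and> jump x s = 0"
    then have s: "0 < s" "s \<le> t" "\<forall>\<^sub>F u in at_left s. x u < z" "\<forall>\<^sub>F u in at_right s. x u > z"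
      using left_sign by (auto simp: ups_def above_def)
    have "x s = z"
      using le[of s] * by (auto simp: jump_def)
    moreover have "\<forall>\<^sub>F u in at_left s. sgn (x s - x u) = sgn (s - u)"
      using s(3) eventually_at_left_less[of s] unfolding \<open>x s = z\<close>
      by eventually_elim auto
    moreover have "\<forall>\<^sub>F u in at_right s. sgn (x s - x u) = sgn (s - u)"
      using s(4) eventually_at_right_less[of s] unfolding \<open>x s = z\<close>
      by eventually_elim auto
    ultimately show "s \<in> incr_times x z \<inter> {0<..t}"
      using s * cadlag_isCont_iff[OF cadlag s(1)]
      by (auto simp: incr_times_def eventually_nhds_conv_at eventually_at_split)
  next
    assume "s \<in> incr_times x z \<inter> {0<..t}"
    then have s: "0 < s" "s \<le> t" "isCont x s" "x s = z"
      and l: "\<forall>\<^sub>F u in at_left s. sgn (z - x u) = sgn (s - u)"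
      and r: "\<forall>\<^sub>F u in at_right s. sgn (z - x u) = sgn (s - u)"
      by (auto simp: incr_times_def eventually_nhds_conv_at eventually_at_split)
    have "\<forall>\<^sub>F u in at_left s. x u < z"
      using l eventually_at_left_less[of s] by eventually_elim (auto simp: sgn_if split: if_splits)
    moreover have "\<forall>\<^sub>F u in at_right s. x u > z"
      using r eventually_at_right_less[of s] by eventually_elim (auto simp: sgn_if split: if_splits)
    ultimately show "s \<in> ups \<and> jump x s = 0"
      using s cadlag_isCont_iff[OF cadlag s(1)] not_above_left by (auto simp: ups_def above_def)
  qed
  then show "{s \<in> ups. jump x s = 0} = incr_times x z \<inter> {0<..t}"
    by blast
  have "s \<in> ups \<and> jump x s \<noteq> 0" if "0 < s" "s \<le> t" "left_lim x s < z" "z < x s" for s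
    using that order_tendstoD(2)[OF cadlag_at_left[OF cadlag that(1)] that(3)]
      order_tendstoD(1)[OF cadlag_at_right[OF cadlag] that(4)] not_above_left
    by (auto simp: ups_def above_def jump_def)
  moreover have "left_lim x s < z \<and> z < x s" if "s \<in> ups" "jump x s \<noteq> 0" for s
    using le[OF that(1)] not_jump_value[of s] that by (force simp: ups_def)
  ultimately show "{s \<in> ups. jump x s \<noteq> 0} = {s. 0 < s \<and> s \<le> t \<and> left_lim x s < z \<and> z < x s}"
    by (auto simp: ups_def)
qed

lemma downs_eq:
  "{s \<in> downs. jump x s = 0} = decr_times x z \<inter> {0<..t}"
  "{s \<in> downs. jump x s \<noteq> 0} = {s. 0 < s \<and> s \<le> t \<and> x s < z \<and> z < left_lim x s}"
proof -
  have le: "z \<le> left_lim x s \<and> x s \<le> z" if "s \<in> downs" for s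
  proof
    have s: "0 < s" "s \<le> t" "\<forall>\<^sub>F u in at_left s. x u > z" "\<forall>\<^sub>F u in at_right s. x u < z"
      using that right_sign[of s] by (auto simp: downs_def above_left_def)
    show "z \<le> left_lim x s"
      by (rule tendsto_lowerbound[OF cadlag_at_left[OF cadlag s(1)]])
        (use s(3) in \<open>auto elim: eventually_mono\<close>)
    show "x s \<le> z"
      by (rule tendsto_upperbound[OF cadlag_at_right[OF cadlag]])
        (use s(1,4) in \<open>auto elim: eventually_mono\<close>)
  qed
  have "s \<in> downs \<and> jump x s = 0 \<longleftrightarrow> s \<in> decr_times x z \<inter> {0<..t}" for s
  proof
    assume *: "s \<in> downs \<and> jump x s = 0"
    then have s: "0 < s" "s \<le> t" "\<forall>\<^sub>F u in at_left s. x u > z" "\<forall>\<^sub>F u in at_right s. x u < z"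
      using right_sign[of s] by (auto simp: downs_def above_left_def)
    have "x s = z"
      using le[of s] * by (auto simp: jump_def)
    moreover have "\<forall>\<^sub>F u in at_left s. sgn (x s - x u) = sgn (u - s)"
      using s(3) eventually_at_left_less[of s] unfolding \<open>x s = z\<close>
      by eventually_elim auto
    moreover have "\<forall>\<^sub>F u in at_right s. sgn (x s - x u) = sgn (u - s)"
      using s(4) eventually_at_right_less[of s] unfolding \<open>x s = z\<close>
      by eventually_elim auto
    ultimately show "s \<in> decr_times x z \<inter> {0<..t}"
      using s * cadlag_isCont_iff[OF cadlag s(1)]
      by (auto simp: decr_times_def eventually_nhds_conv_at eventually_at_split)
  next
    assume "s \<in> decr_times x z \<inter> {0<..t}"
    then have s: "0 < s" "s \<le> t" "isCont x s" "x s = z"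
      and l: "\<forall>\<^sub>F u in at_left s. sgn (z - x u) = sgn (u - s)"
      and r: "\<forall>\<^sub>F u in at_right s. sgn (z - x u) = sgn (u - s)"
      by (auto simp: decr_times_def eventually_nhds_conv_at eventually_at_split)
    have "\<forall>\<^sub>F u in at_left s. x u > z"
      using l eventually_at_left_less[of s] by eventually_elim (auto simp: sgn_if split: if_splits)
    moreover have "\<forall>\<^sub>F u in at_right s. x u < z"
      using r eventually_at_right_less[of s] by eventually_elim (auto simp: sgn_if split: if_splits)
    ultimately show "s \<in> downs \<and> jump x s = 0"
      using s cadlag_isCont_iff[OF cadlag s(1)] not_above
      by (auto simp: downs_def above_left_def)
  qed
  then show "{s \<in> downs. jump x s = 0} = decr_times x z \<inter> {0<..t}"
    by blast
  have "s \<in> downs \<and> jump x s \<noteq> 0" if "0 < s" "s \<le> t" "x s < z" "z < left_lim x s" for s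
    using that order_tendstoD(1)[OF cadlag_at_left[OF cadlag that(1)] that(4)]
      order_tendstoD(2)[OF cadlag_at_right[OF cadlag] that(3)] not_above
    by (auto simp: downs_def above_left_def jump_def)
  moreover have "x s < z \<and> z < left_lim x s" if "s \<in> downs" "jump x s \<noteq> 0" for s
    using le[OF that(1)] not_jump_value[of s] that by (force simp: downs_def)
  ultimately show "{s \<in> downs. jump x s \<noteq> 0} = {s. 0 < s \<and> s \<le> t \<and> x s < z \<and> z < left_lim x s}"
    by (auto simp: downs_def)
qed

lemma finite_monotone_times:
  "finite (incr_times x z \<inter> {0<..t})" "finite (decr_times x z \<inter> {0<..t})"
  using finite_sign_changes by (simp_all flip: ups_eq downs_eq)

lemma finite_jump_crossings:
  "finite {s. 0 < s \<and> s \<le> t \<and> left_lim x s < z \<and> z < x s}"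
  "finite {s. 0 < s \<and> s \<le> t \<and> x s < z \<and> z < left_lim x s}"
  using finite_sign_changes by (simp_all flip: ups_eq downs_eq)

lemma local_time_eq:
  "local_time x z t = of_bool (x t > z) - of_bool (x 0 > z)
     - (real (card {s. 0 < s \<and> s \<le> t \<and> left_lim x s < z \<and> z < x s})
       - real (card {s. 0 < s \<and> s \<le> t \<and> x s < z \<and> z < left_lim x s}))"
proof -
  have split: "card A = card {s\<in>A. jump x s = 0} + card {s\<in>A. jump x s \<noteq> 0}" if "finite A" for A
    using that by (subst card_Un_disjoint[symmetric]) (auto intro: arg_cong[where f = card])
  show ?thesis
    using net_sign_changes split[OF finite_sign_changes(1)] split[OF finite_sign_changes(2)]
    by (simp add: local_time_def ups_eq downs_eq)
qed

end

subsection \<open>Variation and jumps\<close>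

text \<open>Any partition of [s, a] is extended by the point \<open>b\<close>. Monotonicity in the
  endpoint and the bounds on increments and on jump sums all rest on this inequality.\<close>

lemma total_variation_append:
  assumes "s \<le> a" "a \<le> b"
  shows "total_variation x s a + ennreal \<bar>x b - x a\<bar> \<le> total_variation x s b"
proof -
  let ?S = "\<lambda>a. {(n :: nat, p :: nat \<Rightarrow> real). p 0 = s \<and> p n = a \<and> (\<forall>i<n. p i \<le> p (Suc i))}"
  let ?V = "\<lambda>(n, p). ennreal (\<Sum>i<n. \<bar>x (p (Suc i)) - x (p i)\<bar>)"
  have "(1, \<lambda>i. if i = 0 then s else a) \<in> ?S a"
    using assms by auto
  then have "?S a \<noteq> {}" by blast
  then have "total_variation x s a + ennreal \<bar>x b - x a\<bar> =
      (SUP np \<in> ?S a. ?V np + ennreal \<bar>x b - x a\<bar>)"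
    unfolding total_variation_def by (rule ennreal_SUP_add_left[symmetric])
  also have "\<dots> \<le> total_variation x s b"
  proof (rule SUP_least, clarify)
    fix n and p :: "nat \<Rightarrow> real"
    assume p: "s = p 0" "a = p n" "\<forall>i<n. p i \<le> p (Suc i)"
    let ?q = "p(Suc n := b)"
    have "(Suc n, ?q) \<in> ?S b"
      using p assms by (auto simp: less_Suc_eq)
    moreover have "(\<Sum>i<Suc n. \<bar>x (?q (Suc i)) - x (?q i)\<bar>) =
        (\<Sum>i<n. \<bar>x (p (Suc i)) - x (p i)\<bar>) + \<bar>x b - x (p n)\<bar>"
      by simp
    ultimately show "ennreal (\<Sum>i<n. \<bar>x (p (Suc i)) - x (p i)\<bar>) + ennreal \<bar>x b - x (p n)\<bar>
        \<le> total_variation x (p 0) b"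
      unfolding total_variation_def p(1)[symmetric]
      by (intro SUP_upper2[of "(Suc n, ?q)"])
        (auto simp: ennreal_plus[symmetric] sum_nonneg simp del: sum.lessThan_Suc ennreal_plus)
  qed
  finally show ?thesis .
qed

lemma total_variation_mono:
  assumes "s \<le> a" "a \<le> b"
  shows "total_variation x s a \<le> total_variation x s b"
  using total_variation_append[OF assms, of x] by (rule order_trans[rotated]) simp

lemma abs_diff_le_total_variation:
  "s \<le> a \<Longrightarrow> ennreal \<bar>x a - x s\<bar> \<le> total_variation x s a"
  using total_variation_append[of s s a x] by (rule order_trans[rotated]) auto

text \<open>Induction over the largest time \<open>b\<close>: its jump is replaced by the increment
  from \<open>u\<close> to \<open>b\<close>, with \<open>u < b\<close> beyond all other times of the
  sum, and then \<open>u\<close> tends to \<open>b\<close>.\<close>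

lemma sum_jumps_le_total_variation:
  assumes x: "cadlag x" and "finite F" "F \<subseteq> {0<..e}" "0 \<le> e"
  shows "ennreal (\<Sum>s\<in>F. \<bar>jump x s\<bar>) \<le> total_variation x 0 e"
  using assms(2-)
proof (induction F arbitrary: e rule: finite_linorder_max_induct)
  case empty
  then show ?case by simp
next
  case (insert b A)
  have b: "0 < b" "b \<le> e" using insert.prems by auto
  have "\<forall>\<^sub>F u in at_left b. \<forall>a\<in>insert 0 A. a < u"
    using insert.hyps b(1)
    by (intro eventually_ball_finite) (auto simp: eventually_at_left_field)
  then have "\<forall>\<^sub>F u in at_left b.
      ennreal ((\<Sum>s\<in>A. \<bar>jump x s\<bar>) + \<bar>x b - x u\<bar>) \<le> total_variation x 0 b"
    using eventually_at_left_less[of b]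
  proof eventually_elim
    case (elim u)
    then have "ennreal (\<Sum>s\<in>A. \<bar>jump x s\<bar>) \<le> total_variation x 0 u"
      using insert.prems by (intro insert.IH) (auto simp: subset_iff less_imp_le)
    then have "ennreal ((\<Sum>s\<in>A. \<bar>jump x s\<bar>) + \<bar>x b - x u\<bar>) \<le>
        total_variation x 0 u + ennreal \<bar>x b - x u\<bar>"
      by (subst ennreal_plus) (auto intro: sum_nonneg add_right_mono)
    also have "\<dots> \<le> total_variation x 0 b"
      using elim by (intro total_variation_append) auto
    finally show ?case .
  qed
  moreover have "((\<lambda>u. ennreal ((\<Sum>s\<in>A. \<bar>jump x s\<bar>) + \<bar>x b - x u\<bar>)) \<longlongrightarrow>
      ennreal ((\<Sum>s\<in>A. \<bar>jump x s\<bar>) + \<bar>x b - left_lim x b\<bar>)) (at_left b)"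
    by (intro tendsto_ennrealI tendsto_add tendsto_const tendsto_rabs tendsto_diff
        cadlag_at_left[OF x b(1)])
  ultimately have "ennreal ((\<Sum>s\<in>A. \<bar>jump x s\<bar>) + \<bar>x b - left_lim x b\<bar>) \<le> total_variation x 0 b"
    by (rule tendsto_upperbound[rotated, OF _ trivial_limit_at_left_real])
  also have "\<dots> \<le> total_variation x 0 e"
    using b by (intro total_variation_mono) auto
  finally show ?case
    using insert.hyps by (subst sum.insert) (auto simp: jump_def add.commute)
qed

lemma jumps_summable:
  assumes x: "cadlag x" and "0 \<le> t" and tv: "total_variation x 0 t < \<infinity>"
  shows "(\<lambda>s. \<bar>jump x s\<bar>) summable_on {0<..t}"
proof (rule nonneg_bdd_above_summable_on)
  show "bdd_above (sum (\<lambda>s. \<bar>jump x s\<bar>) ` {F. F \<subseteq> {0<..t} \<and> finite F})"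
  proof (rule bdd_aboveI2)
    fix F assume "F \<in> {F. F \<subseteq> {0<..t} \<and> finite F}"
    then have "ennreal (\<Sum>s\<in>F. \<bar>jump x s\<bar>) \<le> total_variation x 0 t"
      using x assms(2) by (intro sum_jumps_le_total_variation) auto
    then show "(\<Sum>s\<in>F. \<bar>jump x s\<bar>) \<le> enn2real (total_variation x 0 t)"
      using tv by (metis enn2real_ennreal enn2real_mono infinity_ennreal_def sum_nonneg abs_ge_zero)
  qed
qed simp

lemma countable_jumps:
  assumes "cadlag x" "0 \<le> t" "total_variation x 0 t < \<infinity>"
  shows "countable {s. 0 < s \<and> s \<le> t \<and> jump x s \<noteq> 0}"
proof -
  have "countable {s \<in> {0<..t}. \<bar>jump x s\<bar> \<noteq> 0}"
    using jumps_summable[OF assms] by (rule summable_countable_real)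
  then show ?thesis by (simp add: conj_assoc)
qed

lemma cadlag_bounded:
  assumes x: "cadlag x" and tv: "total_variation x 0 t < \<infinity>"
  obtains B where "\<And>s. 0 \<le> s \<Longrightarrow> s \<le> t \<Longrightarrow> \<bar>x s\<bar> \<le> B"
    "\<And>s. 0 < s \<Longrightarrow> s \<le> t \<Longrightarrow> \<bar>left_lim x s\<bar> \<le> B"
proof -
  define B where "B = \<bar>x 0\<bar> + enn2real (total_variation x 0 t)"
  have B: "\<bar>x s\<bar> \<le> B" if "0 \<le> s" "s \<le> t" for s
  proof -
    have "ennreal \<bar>x s - x 0\<bar> \<le> total_variation x 0 t"
      using abs_diff_le_total_variation[of 0 s x] total_variation_mono[of 0 s t x] that by auto
    then have "\<bar>x s - x 0\<bar> \<le> enn2real (total_variation x 0 t)"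
      using tv by (metis enn2real_ennreal enn2real_mono infinity_ennreal_def abs_ge_zero)
    then show ?thesis unfolding B_def by linarith
  qed
  moreover have "\<bar>left_lim x s\<bar> \<le> B" if s: "0 < s" "s \<le> t" for s
  proof (rule tendsto_upperbound)
    show "((\<lambda>u. \<bar>x u\<bar>) \<longlongrightarrow> \<bar>left_lim x s\<bar>) (at_left s)"
      by (intro tendsto_rabs cadlag_at_left[OF x s(1)])
    have "\<forall>\<^sub>F u in at_left s. 0 < u"
      using s by (auto simp: eventually_at_left_field)
    then show "\<forall>\<^sub>F u in at_left s. \<bar>x u\<bar> \<le> B"
      using eventually_at_left_less[of s] by eventually_elim (use s B in auto)
  qed simp
  ultimately show ?thesis by (rule that)
qed

text \<open>A local maximum value is the supremum over some smaller interval with rational endpoints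
  around the maximiser, and such intervals are countably many.\<close>

lemma countable_maximum_values:
  fixes x :: "real \<Rightarrow> real"
  shows "countable {z. \<exists>a s b. a < s \<and> s < b \<and> x s = z \<and> (\<forall>u\<in>{a<..<b}. x u \<le> z)}"
proof (rule countable_subset)
  let ?M = "\<lambda>(p, q). Sup (x ` {p<..<q})"
  show "countable (?M ` (\<rat> \<times> \<rat>))"
    by (intro countable_image countable_SIGMA countable_rat)
  show "{z. \<exists>a s b. a < s \<and> s < b \<and> x s = z \<and> (\<forall>u\<in>{a<..<b}. x u \<le> z)} \<subseteq> ?M ` (\<rat> \<times> \<rat>)"
  proof clarify
    fix a s b assume asb: "a < s" "s < b" "\<forall>u\<in>{a<..<b}. x u \<le> x s"
    obtain p q where pq: "p \<in> \<rat>" "q \<in> \<rat>" "a < p" "p < s" "s < q" "q < b"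
      using Rats_dense_in_real asb(1,2) by meson
    then have "Sup (x ` {p<..<q}) = x s"
      using asb(3) by (intro cSup_eq_maximum) auto
    then show "x s \<in> ?M ` (\<rat> \<times> \<rat>)"
      using pq by (auto intro!: image_eqI[of _ _ "(p, q)"])
  qed
qed

lemma AE_generic_level:
  assumes x: "cadlag x" and t: "0 < t" and tv: "total_variation x 0 t < \<infinity>"
  shows "AE z in lborel. generic_level x t z"
proof -
  let ?J = "{s. 0 < s \<and> s \<le> t \<and> jump x s \<noteq> 0}"
  let ?E = "\<lambda>x::real \<Rightarrow> real. {z. \<exists>a s b. a < s \<and> s < b \<and> x s = z \<and> (\<forall>u\<in>{a<..<b}. x u \<le> z)}"
  \<comment> \<open>Local minima of \<open>x\<close> at level \<open>z\<close> are local maxima of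
    \<open>- x\<close> at level \<open>- z\<close>.\<close>
  let ?N = "{x 0, x t} \<union> x ` ?J \<union> left_lim x ` ?J \<union> ?E x \<union> uminus ` ?E (\<lambda>u. - x u)"
  have "countable ?N"
    using countable_jumps[OF x _ tv] t
    by (intro countable_Un countable_image countable_maximum_values) auto
  then have "AE z in lborel. z \<notin> ?N"
    by (intro AE_not_in countable_imp_null_set_lborel)
  with AE_alternates_bounded[OF assms] show ?thesis
  proof eventually_elim
    case (elim z)
    show ?case
    proof
      fix a s b assume asb: "a < s" "s < b" "x s = z"
      have "z \<notin> ?E x" using elim(2) by blast
      then have "\<exists>u\<in>{a<..<b}. z < x u"
        using asb by (auto simp: not_le)
      moreover have "- z \<notin> ?E (\<lambda>u. - x u)"
      proof
        assume "- z \<in> ?E (\<lambda>u. - x u)"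
        then have "z \<in> uminus ` ?E (\<lambda>u. - x u)"
          by (rule image_eqI[rotated]) (rule minus_minus[symmetric])
        with elim(2) show False by blast
      qed
      then have "\<exists>u\<in>{a<..<b}. x u < z"
        using asb by (auto simp: not_le)
      ultimately show "(\<exists>u\<in>{a<..<b}. x u > z) \<and> (\<exists>u\<in>{a<..<b}. x u < z)" ..
    next
      fix s assume "0 < s" "s \<le> t" "jump x s \<noteq> 0"
      then have "s \<in> ?J" by simp
      then show "x s \<noteq> z \<and> left_lim x s \<noteq> z"
        using elim(2) by blast
    qed (use x t elim in blast)+
  qed
qed

subsection \<open>Primitives of locally bounded densities\<close>

text \<open>The Stieltjes measure of \<open>F\<close>, the positive part and the negative part of \<open>h\<close> satisfy
  \<open>P + N = M\<close> on intervals, hence on all Borel sets, in particular on \<open>{z. h z < 0}\<close>.\<close>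

lemma AE_nonneg_if_primitive_mono:
  fixes h F :: "real \<Rightarrow> real"
  assumes h: "h \<in> borel_measurable borel" "set_integrable lborel {a..b} h" and "a \<le> b"
    and F: "continuous_on {a..b} F" "mono_on {a..b} F"
    and F_diff: "\<And>c d. a \<le> c \<Longrightarrow> c \<le> d \<Longrightarrow> d \<le> b \<Longrightarrow> F d - F c = (LINT z:{c..d}|lborel. h z)"
  shows "AE z in lborel. z \<in> {a<..b} \<longrightarrow> 0 \<le> h z"
proof -
  \<comment> \<open>Continues \<open>F\<close> by constants outside [a, b], since a Stieltjes
    measure needs a monotone function on the whole line.\<close>
  define clamp where "clamp y = max a (min b y)" for y
  have clamp: "clamp y \<in> {a..b}" for y
    using \<open>a \<le> b\<close> by (auto simp: clamp_def)
  define P where "P = interval_measure (\<lambda>y. F (clamp y))"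
  \<comment> \<open>\<open>ennreal\<close> sends negative reals to 0, so these densities are the
    positive and the negative part of \<open>h\<close>.\<close>
  define M where "M = density lborel (\<lambda>z. ennreal (h z))"
  define N where "N = density lborel (\<lambda>z. ennreal (- h z))"
  let ?I = "{a<..b}"
  have cont: "continuous_on UNIV (\<lambda>y. F (clamp y))"
    by (rule continuous_on_compose2[OF F(1)])
      (use clamp in \<open>auto simp: clamp_def[abs_def] intro!: continuous_intros\<close>)
  have P_Ioc: "emeasure P {c<..d} = ennreal (F (clamp d) - F (clamp c))" if "c \<le> d" for c d
    unfolding P_def
  proof (rule emeasure_interval_measure_Ioc[OF that])
    fix u v :: real assume "u \<le> v"
    then show "F (clamp u) \<le> F (clamp v)"
      by (intro mono_onD[OF F(2)] clamp) (auto simp: clamp_def)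
  qed (use cont in \<open>auto simp: continuous_on_eq_continuous_within intro: continuous_within_subset\<close>)
  have sets [measurable_cong, simp]: "sets P = sets borel" "sets M = sets borel" "sets N = sets borel"
    by (simp_all add: P_def M_def N_def)
  note h(1)[measurable]
  have Ioc: "emeasure P {c<..d} + emeasure N {c<..d} = emeasure M {c<..d} \<and> emeasure M {c<..d} \<noteq> \<infinity>"
    if cd: "a \<le> c" "c \<le> d" "d \<le> b" for c d
  proof -
    let ?k = "\<lambda>z. indicator {c..d} z * h z"
    have k: "integrable lborel ?k"
      using set_integrable_subset[OF h(2), of "{c..d}"] cd
      by (simp add: set_integrable_def)
    have M: "emeasure M {c<..d} = (\<integral>\<^sup>+z. ennreal (?k z) \<partial>lborel)"
    proof -
      have "AE z in lborel. ennreal (h z) * indicator {c<..d} z = ennreal (?k z)"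
        using AE_lborel_singleton[of c] by eventually_elim (auto simp: indicator_def)
      then show ?thesis
        unfolding M_def by (subst emeasure_density) (auto intro: nn_integral_cong_AE)
    qed
    have N: "emeasure N {c<..d} = (\<integral>\<^sup>+z. ennreal (- ?k z) \<partial>lborel)"
    proof -
      have "AE z in lborel. ennreal (- h z) * indicator {c<..d} z = ennreal (- ?k z)"
        using AE_lborel_singleton[of c] by eventually_elim (auto simp: indicator_def)
      then show ?thesis
        unfolding N_def by (subst emeasure_density) (auto intro: nn_integral_cong_AE)
    qed
    have fin: "emeasure M {c<..d} \<noteq> \<infinity>" "emeasure N {c<..d} \<noteq> \<infinity>"
      using k unfolding M N by (simp_all add: real_integrable_def)
    have "F d - F c = (LINT z|lborel. ?k z)"
      using F_diff[OF cd] by (simp add: set_lebesgue_integral_def)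
    also have "\<dots> = enn2real (emeasure M {c<..d}) - enn2real (emeasure N {c<..d})"
      unfolding M N by (rule real_lebesgue_integral_def[OF k])
    finally have eq: "F d - F c + enn2real (emeasure N {c<..d}) = enn2real (emeasure M {c<..d})"
      by simp
    have "F c \<le> F d"
      using cd by (intro mono_onD[OF F(2)]) auto
    have "emeasure P {c<..d} = ennreal (F d - F c)"
      using P_Ioc[OF cd(2)] cd by (simp add: clamp_def)
    moreover have "ennreal (F d - F c) + ennreal (enn2real (emeasure N {c<..d})) =
        ennreal (enn2real (emeasure M {c<..d}))"
      unfolding eq[symmetric] using \<open>F c \<le> F d\<close> by (subst ennreal_plus) auto
    ultimately show ?thesis
      using fin by (simp add: less_top)
  qed
  have fin: "emeasure M ?I \<noteq> \<infinity>"
    using Ioc[of a b] \<open>a \<le> b\<close> by simp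
  let ?G = "range (\<lambda>(c, d). {c<..d}) :: real set set"
  have borel: "sets borel = sigma_sets UNIV ?G"
    by (simp add: borel_sigma_sets_Ioc)
  have Int_stable: "Int_stable ?G"
    by (auto simp: Int_stable_def)
  \<comment> \<open>Intersecting with the fixed interval keeps the masses of \<open>M\<close>
    finite, so that the complement step may cancel.\<close>
  have eq: "emeasure P (A \<inter> ?I) + emeasure N (A \<inter> ?I) = emeasure M (A \<inter> ?I)" if "A \<in> sets borel" for A
    using Int_stable subset_UNIV[of ?G, folded Pow_UNIV] that[unfolded borel]
  proof (induction rule: sigma_sets_induct_disjoint)
    case (basic A)
    then obtain c d where "A = {c<..d}" by auto
    then have A: "A \<inter> ?I = {max a c<..min b d}" by auto
    show ?case
    proof (cases "max a c \<le> min b d")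
      case True
      then show ?thesis unfolding A using Ioc[of "max a c" "min b d"] by auto
    next
      case False
      then have empty: "A \<inter> ?I = {}" unfolding A by auto
      show ?thesis unfolding empty by simp
    qed
  next
    case empty
    then show ?case by simp
  next
    case (compl A)
    then have [measurable]: "A \<in> sets borel" by (simp add: borel)
    have split: "emeasure R ?I = emeasure R (A \<inter> ?I) + emeasure R ((UNIV - A) \<inter> ?I)"
      if [measurable_cong]: "sets R = sets borel" for R
      by (subst plus_emeasure) (auto intro!: arg_cong[where f = "emeasure R"])
    have "emeasure M (A \<inter> ?I) + emeasure M ((UNIV - A) \<inter> ?I) = emeasure P ?I + emeasure N ?I"
      using Ioc[of a b] \<open>a \<le> b\<close> split[of M] by simp
    also have "\<dots> = (emeasure P (A \<inter> ?I) + emeasure N (A \<inter> ?I)) +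
        (emeasure P ((UNIV - A) \<inter> ?I) + emeasure N ((UNIV - A) \<inter> ?I))"
      by (simp add: split ac_simps)
    finally have "emeasure M (A \<inter> ?I) + emeasure M ((UNIV - A) \<inter> ?I) =
        emeasure M (A \<inter> ?I) + (emeasure P ((UNIV - A) \<inter> ?I) + emeasure N ((UNIV - A) \<inter> ?I))"
      by (simp only: compl.IH)
    moreover have "emeasure M (A \<inter> ?I) \<noteq> \<infinity>"
      using fin emeasure_mono[of "A \<inter> ?I" ?I M] by (auto simp: top_unique)
    ultimately show ?case
      by (auto simp: ennreal_add_left_cancel)
  next
    case (union A)
    then have [measurable]: "A i \<in> sets borel" for i by (auto simp: borel)
    have sum: "emeasure R ((\<Union>i. A i) \<inter> ?I) = (\<Sum>i. emeasure R (A i \<inter> ?I))"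
      if [measurable_cong]: "sets R = sets borel" for R
    proof -
      have "(\<Sum>i. emeasure R (A i \<inter> ?I)) = emeasure R (\<Union>i. A i \<inter> ?I)"
        using union(1) by (intro suminf_emeasure) (auto simp: disjoint_family_on_def)
      then show ?thesis by (simp add: Int_UN_distrib2 Int_commute)
    qed
    show ?case
      unfolding sum[OF sets(1)] sum[OF sets(2)] sum[OF sets(3)]
      by (subst suminf_add) (auto simp: union.IH)
  qed
  have [measurable]: "{z. h z < 0} \<in> sets borel"
    by measurable
  \<comment> \<open>By \<open>P + N = M\<close>, \<open>N\<close> vanishes here as well; its density
    is positive on this set, which is therefore null.\<close>
  have "emeasure M ({z. h z < 0} \<inter> ?I) = 0"
    unfolding M_def by (subst emeasure_density) (auto simp: nn_integral_0_iff_AE indicator_def ennreal_eq_0_iff intro!: AE_I2)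
  with eq[of "{z. h z < 0}"] have "emeasure N ({z. h z < 0} \<inter> ?I) = 0"
    by simp
  then have "AE z in lborel. ennreal (- h z) * indicator ({z. h z < 0} \<inter> ?I) z = 0"
    unfolding N_def by (subst (asm) emeasure_density) (auto simp: nn_integral_0_iff_AE)
  then show ?thesis
    by eventually_elim (auto simp: indicator_def ennreal_eq_0_iff split: if_splits)
qed

section \<open>Integrals of \<open>g\<close> and its essential bound\<close>

lemma set_integrable_lebesgue_iff_lborel:
  fixes g :: "real \<Rightarrow> real"
  assumes "g \<in> borel_measurable borel" "A \<in> sets borel"
  shows "set_integrable lebesgue A g \<longleftrightarrow> set_integrable lborel A g"
  unfolding set_integrable_def using assms by (intro integrable_completion) simp

lemma set_integral_lebesgue_eq_lborel:
  fixes g :: "real \<Rightarrow> real"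
  assumes "g \<in> borel_measurable borel" "A \<in> sets borel"
  shows "(LINT z:A|lebesgue. g z) = (LINT z:A|lborel. g z)"
  unfolding set_lebesgue_integral_def using assms by (intro integral_completion) simp

lemma primitive_diff:
  assumes g: "locally_integrable g" and "a \<le> b"
  shows "primitive f0 g b - primitive f0 g a = (LINT z:{a..b}|lebesgue. g z)"
proof -
  have eq: "(LINT z:{c..d}|lebesgue. g z) = integral {c..d} g" "g integrable_on {c..d}" for c d
    using set_lebesgue_integral_eq_integral[of "{c..d}" g] g by (auto simp: locally_integrable_def)
  have comb: "integral {c..d} g + integral {d..e} g = integral {c..e} g" if "c \<le> d" "d \<le> e" for c d e
    using that eq(2) by (intro Henstock_Kurzweil_Integration.integral_combine)
  show ?thesis
    using \<open>a \<le> b\<close> comb[of 0 a b] comb[of a 0 b] comb[of a b 0]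
    by (auto simp: primitive_def eq(1))
qed

lemma AE_bounded_on_compact:
  fixes g :: "real \<Rightarrow> real"
  assumes "compact K" and loc: "\<And>y. \<exists>e>0. \<exists>L. AE z in M. z \<in> ball y e \<longrightarrow> \<bar>g z\<bar> \<le> L"
  shows "\<exists>L\<ge>0. AE z in M. z \<in> K \<longrightarrow> \<bar>g z\<bar> \<le> L"
proof -
  obtain e L where eL: "\<And>y. e y > 0" "\<And>y. AE z in M. z \<in> ball y (e y) \<longrightarrow> \<bar>g z\<bar> \<le> L y"
    using loc by metis
  have "K \<subseteq> (\<Union>y\<in>K. ball y (e y))"
    using eL(1) by force
  then obtain C where C: "finite C" "K \<subseteq> (\<Union>y\<in>C. ball y (e y))"
    using compactE_image[OF assms(1), of K "\<lambda>y. ball y (e y)"] by (metis open_ball)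
  let ?L = "\<Sum>y\<in>C. \<bar>L y\<bar>"
  have "AE z in M. \<forall>y\<in>C. z \<in> ball y (e y) \<longrightarrow> \<bar>g z\<bar> \<le> L y"
    using C(1) eL(2) by (intro AE_finite_allI)
  then have "AE z in M. z \<in> K \<longrightarrow> \<bar>g z\<bar> \<le> ?L"
  proof eventually_elim
    case (elim z)
    show ?case
    proof
      assume "z \<in> K"
      then obtain y where y: "y \<in> C" "z \<in> ball y (e y)" using C(2) by auto
      then have "\<bar>g z\<bar> \<le> \<bar>L y\<bar>" using elim by fastforce
      also have "\<dots> \<le> ?L"
        using C(1) y(1) by (intro member_le_sum) auto
      finally show "\<bar>g z\<bar> \<le> ?L" .
    qed
  qed
  then show ?thesis by (intro exI[of _ ?L]) (auto intro: sum_nonneg)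
qed

lemma locally_bounded_imp_locally_integrable:
  assumes "g \<in> borel_measurable borel" "locally_bounded g"
  shows "locally_integrable g"
  unfolding locally_integrable_def
proof (intro allI impI)
  fix K :: "real set" assume K: "compact K"
  have "\<exists>e>0. \<exists>L. AE z in lborel. z \<in> ball y e \<longrightarrow> \<bar>g z\<bar> \<le> L" for y
    using assms(2) unfolding locally_bounded_def bounded_iff by (fastforce intro!: AE_I2)
  then obtain L where L: "AE z in lborel. z \<in> K \<longrightarrow> \<bar>g z\<bar> \<le> L"
    using AE_bounded_on_compact[OF K] by blast
  have "set_integrable lborel K g"
    unfolding set_integrable_def
    by (rule integrableI_bounded_set_indicator[where B = L])
      (use K L assms(1) emeasure_compact_finite[OF K] in \<open>auto simp: borel_compact\<close>)
  then show "set_integrable lebesgue K g"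
    using assms K by (simp add: set_integrable_lebesgue_iff_lborel borel_compact)
qed

text \<open>\<open>L * y - f y\<close> and \<open>L * y + f y\<close> are nondecreasing with
  densities \<open>L - g\<close> and \<open>L + g\<close>, so both densities are nonnegative almost
  everywhere.\<close>

lemma AE_abs_le_lipschitz_constant:
  fixes f g :: "real \<Rightarrow> real"
  assumes g: "g \<in> borel_measurable borel" "set_integrable lborel {a..b} g" and "a \<le> b"
    and f: "L-lipschitz_on {a..b} f"
    and f_diff: "\<And>c d. a \<le> c \<Longrightarrow> c \<le> d \<Longrightarrow> d \<le> b \<Longrightarrow> f d - f c = (LINT z:{c..d}|lborel. g z)"
  shows "AE z in lborel. z \<in> {a<..b} \<longrightarrow> \<bar>g z\<bar> \<le> L"
proof -
  have L_int: "set_integrable lborel {c..d} (\<lambda>_. L)" for c d :: real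
    by (rule borel_integrable_atLeastAtMost'[OF continuous_on_const])
  have L_eq: "(LINT z:{c..d}|lborel. L) = L * d - L * c" if "c \<le> d" for c d :: real
    using that by (simp add: set_integral_const set_lebesgue_integral_def algebra_simps)
  have g_int: "set_integrable lborel {c..d} g" if "a \<le> c" "d \<le> b" for c d
    by (rule set_integrable_subset[OF g(2)]) (use that in auto)
  have cont: "continuous_on {a..b} f"
    by (rule lipschitz_on_continuous_on[OF f])
  have lip: "\<bar>f d - f c\<bar> \<le> L * (d - c)" if "a \<le> c" "c \<le> d" "d \<le> b" for c d
    using lipschitz_onD[OF f, of d c] that by (simp add: dist_real_def)
  have "AE z in lborel. z \<in> {a<..b} \<longrightarrow> 0 \<le> L - g z"
  proof (rule AE_nonneg_if_primitive_mono[where F = "\<lambda>y. L * y - f y"])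
    show "mono_on {a..b} (\<lambda>y. L * y - f y)"
    proof (rule mono_onI)
      fix c d assume "c \<in> {a..b}" "d \<in> {a..b}" "c \<le> d"
      then show "L * c - f c \<le> L * d - f d"
        using lip[of c d] by (simp add: abs_le_iff algebra_simps)
    qed
    show "L * d - f d - (L * c - f c) = (LINT z:{c..d}|lborel. L - g z)"
      if "a \<le> c" "c \<le> d" "d \<le> b" for c d
      using that L_int g_int f_diff[OF that] by (simp add: set_integral_diff L_eq)
  qed (use g \<open>a \<le> b\<close> cont L_int in \<open>auto intro!: continuous_intros set_integral_diff\<close>)
  moreover have "AE z in lborel. z \<in> {a<..b} \<longrightarrow> 0 \<le> L + g z"
  proof (rule AE_nonneg_if_primitive_mono[where F = "\<lambda>y. L * y + f y"])
    show "mono_on {a..b} (\<lambda>y. L * y + f y)"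
    proof (rule mono_onI)
      fix c d assume "c \<in> {a..b}" "d \<in> {a..b}" "c \<le> d"
      then show "L * c + f c \<le> L * d + f d"
        using lip[of c d] by (simp add: abs_le_iff algebra_simps)
    qed
    show "L * d + f d - (L * c + f c) = (LINT z:{c..d}|lborel. L + g z)"
      if "a \<le> c" "c \<le> d" "d \<le> b" for c d
      using that L_int g_int f_diff[OF that] by (simp add: set_integral_add L_eq)
  qed (use g \<open>a \<le> b\<close> cont L_int in \<open>auto intro!: continuous_intros set_integral_add\<close>)
  ultimately show ?thesis
    by eventually_elim auto
qed

text \<open>Brings the two alternatives on \<open>f\<close> and \<open>g\<close> to common terms.
  The bound is an essential one because in the Lipschitz case \<open>g\<close> may be unbounded on a
  null set.\<close>

lemma primitive_regularity:
  assumes g: "g \<in> borel_measurable borel"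
    and fg: "locally_bounded g \<and> f = primitive f0 g \<or>
      locally_lipschitz f \<and> locally_integrable g \<and> f = primitive f0 g"
  shows "locally_integrable g"
    and "a \<le> b \<Longrightarrow> f b - f a = (LINT z:{a..b}|lborel. g z)"
    and "\<exists>L\<ge>0. AE z in lborel. \<bar>z\<bar> \<le> B \<longrightarrow> \<bar>g z\<bar> \<le> L"
proof -
  show int: "locally_integrable g"
    using fg g locally_bounded_imp_locally_integrable by blast
  have diff: "f b - f a = (LINT z:{a..b}|lborel. g z)" if "a \<le> b" for a b
    using fg primitive_diff[OF int that] g by (auto simp: set_integral_lebesgue_eq_lborel)
  then show "a \<le> b \<Longrightarrow> f b - f a = (LINT z:{a..b}|lborel. g z)" .
  have "\<exists>e>0. \<exists>L. AE z in lborel. z \<in> ball y e \<longrightarrow> \<bar>g z\<bar> \<le> L" for y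
    using fg
  proof
    assume "locally_bounded g \<and> f = primitive f0 g"
    then show ?thesis
      unfolding locally_bounded_def bounded_iff by (fastforce intro!: AE_I2)
  next
    assume "locally_lipschitz f \<and> locally_integrable g \<and> f = primitive f0 g"
    then obtain e L where eL: "e > 0" "L-lipschitz_on (ball y e) f"
      unfolding locally_lipschitz_def by blast
    \<comment> \<open>Halving the radius puts the closed interval inside the open ball.\<close>
    let ?a = "y - e / 2" and ?b = "y + e / 2"
    have "AE z in lborel. z \<in> {?a<..?b} \<longrightarrow> \<bar>g z\<bar> \<le> L"
    proof (rule AE_abs_le_lipschitz_constant[OF g])
      show "set_integrable lborel {?a..?b} g"
        using int g by (simp add: locally_integrable_def flip: set_integrable_lebesgue_iff_lborel)
      show "L-lipschitz_on {?a..?b} f"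
        by (rule lipschitz_on_subset[OF eL(2)]) (use eL(1) in \<open>auto simp: dist_real_def\<close>)
    qed (use eL(1) diff in auto)
    then have "AE z in lborel. z \<in> ball y (e / 2) \<longrightarrow> \<bar>g z\<bar> \<le> L"
      by eventually_elim (auto simp: ball_eq_greaterThanLessThan)
    then show ?thesis
      using eL(1) half_gt_zero by blast
  qed
  then have "\<exists>L\<ge>0. AE z in lborel. z \<in> {- B..B} \<longrightarrow> \<bar>g z\<bar> \<le> L"
    by (intro AE_bounded_on_compact) auto
  then show "\<exists>L\<ge>0. AE z in lborel. \<bar>z\<bar> \<le> B \<longrightarrow> \<bar>g z\<bar> \<le> L"
    by (simp add: abs_le_iff minus_le_iff conj_commute)
qed

subsection \<open>Integration over the levels\<close>

text \<open>Net contribution to level \<open>z\<close> of a move from \<open>c\<close> to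
  \<open>d\<close>. The open ends match the strict inequalities of the jump counts.\<close>

definition crossing :: "real \<Rightarrow> real \<Rightarrow> real \<Rightarrow> real" where
  "crossing c d z = of_bool (c < z \<and> z < d) - of_bool (d < z \<and> z < c)"

lemma crossing_commute: "crossing d c z = - crossing c d z"
  by (simp add: crossing_def)

lemma abs_crossing: "\<bar>crossing c d z\<bar> = indicator {min c d<..<max c d} z"
  by (auto simp: crossing_def indicator_def)

lemma crossing_measurable [measurable]: "crossing c d \<in> borel_measurable borel"
  unfolding crossing_def[abs_def] by measurable

lemma integral_crossing:
  fixes f g :: "real \<Rightarrow> real"
  assumes g: "g \<in> borel_measurable borel" "locally_integrable g"
    and f: "\<And>a b. a \<le> b \<Longrightarrow> f b - f a = (LINT z:{a..b}|lborel. g z)"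
  shows "integrable lborel (\<lambda>z. crossing c d z * g z)"
    and "(LINT z|lborel. crossing c d z * g z) = f d - f c"
proof -
  have *: "integrable lborel (\<lambda>z. crossing c d z * g z) \<and>
      (LINT z|lborel. crossing c d z * g z) = f d - f c" if "c \<le> d" for c d
  proof -
    have int: "integrable lborel (\<lambda>z. indicator {c..d} z * g z)"
      using g set_integrable_lebesgue_iff_lborel[OF g(1), of "{c..d}"]
      by (simp add: locally_integrable_def set_integrable_def)
    have eq: "AE z in lborel. indicator {c..d} z * g z = crossing c d z * g z"
      using AE_lborel_singleton[of c] AE_lborel_singleton[of d]
      by eventually_elim (use that in \<open>auto simp: crossing_def indicator_def\<close>)
    have meas: "(\<lambda>z. crossing c d z * g z) \<in> borel_measurable lborel"
      using g(1) by simp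
    have "(LINT z|lborel. indicator {c..d} z * g z) = (LINT z|lborel. crossing c d z * g z)"
      using int meas eq by (intro integral_cong_AE) auto
    then show ?thesis
      using integrable_cong_AE_imp[OF int meas] eq f[OF that]
      by (simp add: set_lebesgue_integral_def)
  qed
  show "integrable lborel (\<lambda>z. crossing c d z * g z)"
    "(LINT z|lborel. crossing c d z * g z) = f d - f c"
    using *[of c d] *[of d c] by (cases "c \<le> d"; simp add: crossing_commute[of d c])+
qed

text \<open>Dominates the contribution of one jump by a multiple of its size, which justifies
  interchanging sum and integral.\<close>

lemma integral_abs_crossing_le:
  fixes g :: "real \<Rightarrow> real"
  assumes "integrable lborel (\<lambda>z. crossing c d z * g z)"
    and L: "AE z in lborel. \<bar>z\<bar> \<le> B \<longrightarrow> \<bar>g z\<bar> \<le> L" and "\<bar>c\<bar> \<le> B" "\<bar>d\<bar> \<le> B"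
  shows "(LINT z|lborel. norm (crossing c d z * g z)) \<le> L * \<bar>d - c\<bar>"
proof -
  let ?I = "{min c d<..<max c d}"
  have "(LINT z|lborel. norm (crossing c d z * g z)) \<le> (LINT z|lborel. L * indicator ?I z)"
  proof (rule integral_mono_AE)
    show "AE z in lborel. norm (crossing c d z * g z) \<le> L * indicator ?I z"
      using L
    proof eventually_elim
      case (elim z)
      have "z \<in> ?I \<Longrightarrow> \<bar>z\<bar> \<le> B"
        using assms(3,4) by auto
      with elim show ?case
        by (auto simp: abs_mult abs_crossing indicator_def)
    qed
  qed (use assms(1) in auto)
  also have "\<dots> = L * \<bar>d - c\<bar>"
    by (auto simp: max_def min_def)
  finally show ?thesis .
qed

text \<open>Measurability of \<open>v\<close> comes from the completeness of Lebesgue measure. This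
  is how integrability reaches the crossing counts and the local time.\<close>

lemma integrable_lebesgue_cong_AE:
  fixes u v :: "real \<Rightarrow> real"
  assumes u: "integrable lebesgue u" and eq: "AE z in lebesgue. u z = v z"
  shows "integrable lebesgue v" "(LINT z|lebesgue. v z) = (LINT z|lebesgue. u z)"
proof -
  have neg: "negligible {z. u z \<noteq> v z}"
    using eq by (simp add: negligible_iff_null_sets completion.AE_iff_null_sets)
  have "set_integrable lebesgue UNIV u"
    using u by (simp add: set_integrable_def)
  then have "set_integrable lebesgue UNIV v"
    by (rule absolutely_integrable_spike[OF _ neg]) auto
  then show v: "integrable lebesgue v"
    by (simp add: set_integrable_def)
  show "(LINT z|lebesgue. v z) = (LINT z|lebesgue. u z)"
    using u v eq by (intro integral_cong_AE) auto
qed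

text \<open>Transports a family over a countable index set to the naturals, where the library has
  term-by-term integration of series.\<close>

definition nat_extension :: "'a set \<Rightarrow> ('a \<Rightarrow> real) \<Rightarrow> nat \<Rightarrow> real" where
  "nat_extension J \<phi> n = (if n \<in> to_nat_on J ` J then \<phi> (from_nat_into J n) else 0)"

lemma has_sum_nat_extension:
  assumes "countable J"
  shows "(nat_extension J \<phi> has_sum S) UNIV \<longleftrightarrow> (\<phi> has_sum S) J"
proof -
  have "(nat_extension J \<phi> has_sum S) UNIV \<longleftrightarrow> (nat_extension J \<phi> has_sum S) (to_nat_on J ` J)"
    by (rule has_sum_cong_neutral) (auto simp: nat_extension_def)
  also have "\<dots> \<longleftrightarrow> (nat_extension J \<phi> \<circ> to_nat_on J has_sum S) J"
    using assms by (intro has_sum_reindex inj_on_to_nat_on)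
  also have "\<dots> \<longleftrightarrow> (\<phi> has_sum S) J"
    using assms by (intro has_sum_cong) (auto simp: nat_extension_def)
  finally show ?thesis .
qed

text \<open>Fubini over the jumps: the integrals of the norms are at most \<open>L\<close> times the
  summable sizes of the moves, and for almost every \<open>z\<close> only finitely many terms are
  nonzero, so the pointwise series is the finite count \<open>C z\<close> times
  \<open>g z\<close>.\<close>

lemma has_sum_integral_crossing:
  fixes f g :: "real \<Rightarrow> real" and a b :: "'a \<Rightarrow> real"
  assumes J: "countable J" "(\<lambda>s. \<bar>b s - a s\<bar>) summable_on J"
    and g: "g \<in> borel_measurable borel" "locally_integrable g"
    and f: "\<And>c d. c \<le> d \<Longrightarrow> f d - f c = (LINT z:{c..d}|lborel. g z)"
    and L: "AE z in lborel. \<bar>z\<bar> \<le> B \<longrightarrow> \<bar>g z\<bar> \<le> L"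
    and B: "\<And>s. s \<in> J \<Longrightarrow> \<bar>a s\<bar> \<le> B \<and> \<bar>b s\<bar> \<le> B"
    and fin: "AE z in lborel. finite {s \<in> J. a s < z \<and> z < b s} \<and> finite {s \<in> J. b s < z \<and> z < a s}"
  defines "C z \<equiv> real (card {s \<in> J. a s < z \<and> z < b s}) - real (card {s \<in> J. b s < z \<and> z < a s})"
  shows "integrable lebesgue (\<lambda>z. C z * g z)"
    and "((\<lambda>s. f (b s) - f (a s)) has_sum (LINT z|lebesgue. C z * g z)) J"
proof -
  define k where "k n z = nat_extension J (\<lambda>s. crossing (a s) (b s) z * g z) n" for n z
  note cr = integral_crossing[OF g f]
  have k_int: "integrable lborel (k n)" for n
    using cr(1) by (cases "n \<in> to_nat_on J ` J") (simp_all add: k_def[abs_def] nat_extension_def)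
  have k_eq: "(LINT z|lborel. k n z) = nat_extension J (\<lambda>s. f (b s) - f (a s)) n" for n
    using cr(2) by (cases "n \<in> to_nat_on J ` J") (simp_all add: k_def nat_extension_def)
  have k_norm: "(LINT z|lborel. norm (k n z)) \<le> L * nat_extension J (\<lambda>s. \<bar>b s - a s\<bar>) n" for n
  proof (cases "n \<in> to_nat_on J ` J")
    case True
    then have "from_nat_into J n \<in> J"
      using J(1) by auto
    then show ?thesis
      using integral_abs_crossing_le[OF cr(1) L] B True by (simp add: k_def nat_extension_def)
  qed (simp add: k_def nat_extension_def)
  have "summable (nat_extension J (\<lambda>s. \<bar>b s - a s\<bar>))"
    using J has_sum_nat_extension[OF J(1)] unfolding summable_on_def
    by (metis has_sum_imp_sums sums_summable)
  then have "summable (\<lambda>n. L * nat_extension J (\<lambda>s. \<bar>b s - a s\<bar>) n)"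
    by (rule summable_mult)
  then have sum_norm: "summable (\<lambda>n. LINT z|lborel. norm (k n z))"
    by (rule summable_comparison_test'[where N = 0]) (use k_norm in auto)
  have pointwise: "summable (\<lambda>n. norm (k n z)) \<and> (\<Sum>n. k n z) = C z * g z"
    if z: "finite {s \<in> J. a s < z \<and> z < b s} \<and> finite {s \<in> J. b s < z \<and> z < a s}" for z
  proof -
    let ?U = "{s \<in> J. a s < z \<and> z < b s}" and ?D = "{s \<in> J. b s < z \<and> z < a s}"
    have "((\<lambda>s. crossing (a s) (b s) z * g z) has_sum
        (\<Sum>s\<in>?U \<union> ?D. crossing (a s) (b s) z * g z)) (?U \<union> ?D)"
      using z by (intro has_sum_finite) auto
    also have "(\<Sum>s\<in>?U \<union> ?D. crossing (a s) (b s) z * g z) =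
        (\<Sum>s\<in>?U. crossing (a s) (b s) z * g z) + (\<Sum>s\<in>?D. crossing (a s) (b s) z * g z)"
      using z by (intro sum.union_disjoint) auto
    also have "(\<Sum>s\<in>?U. crossing (a s) (b s) z * g z) = (\<Sum>s\<in>?U. g z)"
      by (intro sum.cong) (auto simp: crossing_def)
    also have "(\<Sum>s\<in>?D. crossing (a s) (b s) z * g z) = (\<Sum>s\<in>?D. - g z)"
      by (intro sum.cong) (auto simp: crossing_def)
    also have "(\<Sum>s\<in>?U. g z) + (\<Sum>s\<in>?D. - g z) = C z * g z"
      by (simp add: C_def left_diff_distrib)
    also have "((\<lambda>s. crossing (a s) (b s) z * g z) has_sum C z * g z) (?U \<union> ?D) \<longleftrightarrow>
        ((\<lambda>s. crossing (a s) (b s) z * g z) has_sum C z * g z) J"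
      by (rule has_sum_cong_neutral) (auto simp: crossing_def)
    finally have "(\<lambda>n. k n z) sums (C z * g z)"
      unfolding k_def using has_sum_nat_extension[OF J(1)] by (metis has_sum_imp_sums)
    moreover have "summable (\<lambda>n. norm (k n z))"
    proof (rule summable_finite)
      show "finite (to_nat_on J ` (?U \<union> ?D))"
        using z by auto
      show "norm (k n z) = 0" if "n \<notin> to_nat_on J ` (?U \<union> ?D)" for n
        using that J(1) by (auto simp: k_def nat_extension_def crossing_def)
    qed
    ultimately show ?thesis by (auto simp: sums_iff)
  qed
  have ae: "AE z in lborel. summable (\<lambda>n. norm (k n z))"
    using fin by eventually_elim (use pointwise in blast)
  have sum_int: "integrable lborel (\<lambda>z. \<Sum>n. k n z)"
    by (rule integrable_suminf[OF k_int ae sum_norm])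
  then have "integrable lebesgue (\<lambda>z. \<Sum>n. k n z)"
    by (subst integrable_completion) auto
  moreover have "AE z in lebesgue. (\<Sum>n. k n z) = C z * g z"
    using AE_completion[OF fin] by eventually_elim (use pointwise in blast)
  ultimately have *: "integrable lebesgue (\<lambda>z. C z * g z)"
    "(LINT z|lebesgue. C z * g z) = (LINT z|lebesgue. (\<Sum>n. k n z))"
    by (rule integrable_lebesgue_cong_AE)+
  show "integrable lebesgue (\<lambda>z. C z * g z)" by (rule *)
  have "(LINT z|lebesgue. (\<Sum>n. k n z)) = (LINT z|lborel. (\<Sum>n. k n z))"
    using sum_int by (intro integral_completion) auto
  then have "nat_extension J (\<lambda>s. f (b s) - f (a s)) sums (LINT z|lebesgue. C z * g z)"
    using sums_integral[OF k_int ae sum_norm] by (simp add: * k_eq)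
  \<comment> \<open>Absolute convergence upgrades the ordered series to an unordered sum.\<close>
  moreover have "summable (\<lambda>n. norm (nat_extension J (\<lambda>s. f (b s) - f (a s)) n))"
  proof (rule summable_comparison_test'[OF sum_norm, where N = 0])
    show "norm (norm (nat_extension J (\<lambda>s. f (b s) - f (a s)) n)) \<le> (LINT z|lborel. norm (k n z))" for n
      unfolding k_eq[symmetric] by simp
  qed
  ultimately have "(nat_extension J (\<lambda>s. f (b s) - f (a s)) has_sum (LINT z|lebesgue. C z * g z)) UNIV"
    by (intro norm_summable_imp_has_sum)
  then show "((\<lambda>s. f (b s) - f (a s)) has_sum (LINT z|lebesgue. C z * g z)) J"
    using has_sum_nat_extension[OF J(1)] by blast
qed

theorem proposition4p2:
  fixes x f g :: "real \<Rightarrow> real" and t :: real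
  assumes x: "cadlag_fv x"
    and fg: "(g \<in> borel_measurable borel \<and> locally_bounded g \<and> (\<exists>f0. f = primitive f0 g)) \<or>
             (locally_lipschitz f \<and> g \<in> borel_measurable borel \<and> locally_integrable g \<and>
              f = primitive (f 0) g \<and> f = primitive (f 0) (deriv f))"
    and t: "t > 0"
  shows "(AE z in lebesgue. level_up z x 0 t \<noteq> \<infinity> \<and> level_down z x 0 t \<noteq> \<infinity>) \<and>
    integrable lebesgue (\<lambda>z. net_crossings z x 0 t * g z) \<and>
    f (x t) - f (x 0) = (LINT z|lebesgue. net_crossings z x 0 t * g z) \<and>
    (AE z in lebesgue. finite (incr_times x z \<inter> {0<..t}) \<and> finite (decr_times x z \<inter> {0<..t})) \<and>
    integrable lebesgue (\<lambda>z. local_time x z t * g z) \<and>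
    (\<lambda>s. f (x s) - f (left_lim x s)) summable_on {s. 0 < s \<and> s \<le> t \<and> jump x s \<noteq> 0} \<and>
    (LINT z|lebesgue. net_crossings z x 0 t * g z) =
      (LINT z|lebesgue. local_time x z t * g z) +
      (\<Sum>\<^sub>\<infinity>s\<in>{s. 0 < s \<and> s \<le> t \<and> jump x s \<noteq> 0}. f (x s) - f (left_lim x s))"
proof -
  have cad: "cadlag x" and tv: "total_variation x 0 t < \<infinity>"
    using x t by (auto simp: cadlag_fv_def)
  have g: "g \<in> borel_measurable borel"
    using fg by blast
  obtain f0 where f0: "locally_bounded g \<and> f = primitive f0 g \<or>
      locally_lipschitz f \<and> locally_integrable g \<and> f = primitive f0 g"
    using fg by blast
  note reg = primitive_regularity[OF g f0]
  note cr = integral_crossing[OF g reg(1) reg(2)]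
  obtain B where B: "\<And>s. 0 \<le> s \<Longrightarrow> s \<le> t \<Longrightarrow> \<bar>x s\<bar> \<le> B"
    "\<And>s. 0 < s \<Longrightarrow> s \<le> t \<Longrightarrow> \<bar>left_lim x s\<bar> \<le> B"
    using cadlag_bounded[OF cad tv] by metis
  obtain L where L: "AE z in lborel. \<bar>z\<bar> \<le> B \<longrightarrow> \<bar>g z\<bar> \<le> L"
    using reg(3) by blast
  have ae: "AE z in lebesgue. generic_level x t z"
    by (rule AE_completion[OF AE_generic_level[OF cad t tv]])

  let ?J = "{s. 0 < s \<and> s \<le> t \<and> jump x s \<noteq> 0}"
  \<comment> \<open>The index set \<open>?J\<close> fits the summation lemma; passing strictly over
    \<open>z\<close> already forces a jump, so these are the counts of
    \<open>local_time_eq\<close>.\<close>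
  define C where "C z = real (card {s \<in> ?J. left_lim x s < z \<and> z < x s})
    - real (card {s \<in> ?J. x s < z \<and> z < left_lim x s})" for z
  have jumps_eq: "{s \<in> ?J. left_lim x s < z \<and> z < x s} = {s. 0 < s \<and> s \<le> t \<and> left_lim x s < z \<and> z < x s}"
    "{s \<in> ?J. x s < z \<and> z < left_lim x s} = {s. 0 < s \<and> s \<le> t \<and> x s < z \<and> z < left_lim x s}" for z
    by (auto simp: jump_def)
  have "(\<lambda>s. \<bar>jump x s\<bar>) summable_on ?J"
    by (rule summable_on_subset_banach[OF jumps_summable[OF cad less_imp_le[OF t] tv]]) auto
  then have J: "countable ?J" "(\<lambda>s. \<bar>x s - left_lim x s\<bar>) summable_on ?J"
    using countable_jumps[OF cad less_imp_le[OF t] tv] by (simp_all add: jump_def)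
  have fin: "AE z in lborel. finite {s \<in> ?J. left_lim x s < z \<and> z < x s} \<and>
      finite {s \<in> ?J. x s < z \<and> z < left_lim x s}"
    unfolding jumps_eq using AE_generic_level[OF cad t tv]
    by eventually_elim (simp add: generic_level.finite_jump_crossings)
  have C: "integrable lebesgue (\<lambda>z. C z * g z)"
    "((\<lambda>s. f (x s) - f (left_lim x s)) has_sum (LINT z|lebesgue. C z * g z)) ?J"
    unfolding C_def
    by (rule has_sum_integral_crossing[OF J g reg(1) reg(2) L _ fin]; use B in auto)+

  \<comment> \<open>A Borel representative of the first integrand, from which the net crossings
    inherit integrability.\<close>
  let ?N = "\<lambda>z. crossing (x 0) (x t) z * g z"
  have N: "integrable lebesgue ?N" "(LINT z|lebesgue. ?N z) = f (x t) - f (x 0)"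
    using cr[of "x 0" "x t"] g by (simp_all add: integrable_completion integral_completion)
  have crossing_eq: "of_bool (x t > z) - of_bool (x 0 > z) = crossing (x 0) (x t) z"
    if "generic_level x t z" for z
    using generic_level.endpoints[OF that] by (auto simp: crossing_def)
  have levels: "level_up z x 0 t \<noteq> \<infinity> \<and> level_down z x 0 t \<noteq> \<infinity> \<and>
      net_crossings z x 0 t = crossing (x 0) (x t) z" if z: "generic_level x t z" for z
    using generic_level.alternates_bounded[OF z] generic_level.endpoints[OF z] crossing_eq[OF z]
      level_crossings_of_alternates_bounded[OF cad t] by metis
  have local: "local_time x z t = crossing (x 0) (x t) z - C z" if z: "generic_level x t z" for z
    using generic_level.local_time_eq[OF z] crossing_eq[OF z] unfolding C_def jumps_eq by simp
  have "AE z in lebesgue. ?N z = net_crossings z x 0 t * g z"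
    using ae by eventually_elim (simp add: levels)
  note net = integrable_lebesgue_cong_AE[OF N(1) this]
  have "AE z in lebesgue. ?N z - C z * g z = local_time x z t * g z"
    using ae by eventually_elim (simp add: local left_diff_distrib)
  note loc = integrable_lebesgue_cong_AE[OF Bochner_Integration.integrable_diff[OF N(1) C(1)] this]
  have "AE z in lebesgue. level_up z x 0 t \<noteq> \<infinity> \<and> level_down z x 0 t \<noteq> \<infinity>"
    using ae by eventually_elim (simp add: levels)
  moreover have "AE z in lebesgue. finite (incr_times x z \<inter> {0<..t}) \<and> finite (decr_times x z \<inter> {0<..t})"
    using ae by eventually_elim (simp add: generic_level.finite_monotone_times)
  moreover have "(LINT z|lebesgue. local_time x z t * g z) =
      (LINT z|lebesgue. ?N z) - (LINT z|lebesgue. C z * g z)"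
    unfolding loc(2) using N(1) C(1) by (rule Bochner_Integration.integral_diff)
  moreover have "(\<Sum>\<^sub>\<infinity>s\<in>?J. f (x s) - f (left_lim x s)) = (LINT z|lebesgue. C z * g z)"
    using C(2) by (rule infsumI)
  moreover have "(\<lambda>s. f (x s) - f (left_lim x s)) summable_on ?J"
    using C(2) by (rule has_sum_imp_summable)
  ultimately show ?thesis
    using net loc(1) N(2) by simp
qed

end
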